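(* Let $1\le k\le n$ be integers and let $\mathcal{F}$ denote the Fourier transform on $\mathcal{S}'(\mathbb{R}^n)$. Then $\mathcal{F}[\mathcal{G}_k]=\mathcal{F}_k$ and $\mathcal{F}^{-1}[\mathcal{F}_k]=\mathcal{G}_k$.
   Context: $\mathcal{S}(\mathbb{R}^n)$ is the Schwartz space of complex-valued functions and $\mathcal{S}'(\mathbb{R}^n)$ its dual (tempered distributions). For a suitable function $f$, $T_f$ is the distribution $\langle T_f,\phi\rangle=\int f(\mathbf{x})\phi(\mathbf{x})\,d\mathbf{x}$. The Fourier transform on $\mathcal{S}(\mathbb{R}^n)$ is $\mathcal{F}[\phi](\mathbf{x})=\int_{\mathbb{R}^n}\phi(\mathbf{y})e^{-\mathrm{i}\mathbf{x}^T\mathbf{y}}d\mathbf{y}$, extended to $\mathcal{S}'(\mathbb{R}^n)$ by $\langle\mathcal{F}[T],\phi\rangle=\langle T,\mathcal{F}[\phi]\rangle$; $\mathcal{F}^{-1}$ is its inverse. For $g\in\mathcal{S}'(\mathbb{R}^k)$, $g\otimes\delta^{n-k}\in\mathcal{S}'(\mathbb{R}^n)$ is the tensor product of $g$ with the $(n-k)$-dimensional Dirac delta at the origin; for $g=T_f$, $\langle T_f\otimes\delta^{n-k},\phi\rangle=\int_{\mathbb{R}^k}f(\mathbf{x}_{1:k})\phi(\mathbf{x}_{1:k},\mathbf{0}_{n-k})\,d\mathbf{x}_{1:k}$ (for $k=n$ the factor $\delta^{0}$ is omitted). For $g\in\mathcal{S}'(\mathbb{R}^n)$ and an orthogonal matrix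 $U$, $g_U\in\mathcal{S}'(\mathbb{R}^n)$ is defined by $\langle g_U,\phi\rangle=\langle g,\psi\rangle$, $\psi(\mathbf{x})=\phi(U^T\mathbf{x})$. Put $\mathcal{O}(n)=\{U\in\mathbb{R}^{n\times n}: U^TU=I_n\}$, $$\mathcal{G}_k=\{(T_f\otimes\delta^{n-k})_U : f\in\mathcal{S}(\mathbb{R}^k),\ U\in\mathcal{O}(n)\},$$ $$\mathcal{F}_k=\{T_r : r(\mathbf{x})=f(U\mathbf{x}),\ f\in\mathcal{S}(\mathbb{R}^k),\ U\in\mathbb{R}^{k\times n},\ \operatorname{rank}(U)=k\}.$$ *)

theory Defs
  imports "HOL-Analysis.Analysis"
begin

definition partial_deriv :: "'n::finite \<Rightarrow> (real^'n \<Rightarrow> complex) \<Rightarrow> real^'n \<Rightarrow> complex" where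
  "partial_deriv i \<phi> x = frechet_derivative \<phi> (at x) (axis i 1)"

text \<open>
  Derivatives are indexed by finite sequences of coordinates instead of multi-indices. For smooth
  functions the order is irrelevant, so the same family of derivatives is obtained.
\<close>
definition partial_derivs :: "'n::finite list \<Rightarrow> (real^'n \<Rightarrow> complex) \<Rightarrow> real^'n \<Rightarrow> complex" where
  "partial_derivs \<beta> \<phi> = foldr partial_deriv \<beta> \<phi>"

text \<open>
  All iterated partial derivatives are totally differentiable; in particular they are continuous,
  so this is the usual class of infinitely differentiable functions.
\<close>
definition smooth :: "(real^'n::finite \<Rightarrow> complex) \<Rightarrow> bool" where
  "smooth \<phi> \<longleftrightarrow> (\<forall>\<beta>. partial_derivs \<beta> \<phi> differentiable_on UNIV)"

definition monomial :: "('n::finite \<Rightarrow> nat) \<Rightarrow> real^'n \<Rightarrow> real" where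
  "monomial \<alpha> x = (\<Prod>i\<in>UNIV. (x $ i) ^ \<alpha> i)"

definition schwartz :: "(real^'n::finite \<Rightarrow> complex) set" where
  "schwartz = {\<phi>. smooth \<phi> \<and>
     (\<forall>\<alpha> \<beta>. bounded (range (\<lambda>x. monomial \<alpha> x *\<^sub>R partial_derivs \<beta> \<phi> x)))}"

definition schwartz_seminorm ::
    "('n::finite \<Rightarrow> nat) \<Rightarrow> 'n list \<Rightarrow> (real^'n \<Rightarrow> complex) \<Rightarrow> real" where
  "schwartz_seminorm \<alpha> \<beta> \<phi> = (SUP x. norm (monomial \<alpha> x *\<^sub>R partial_derivs \<beta> \<phi> x))"

definition schwartz_topology :: "(real^'n::finite \<Rightarrow> complex) topology" where
  "schwartz_topology = topology_generated_by
     {{\<psi> \<in> schwartz. schwartz_seminorm \<alpha> \<beta> (\<lambda>x. \<psi> x - \<phi> x) < \<epsilon>} | \<alpha> \<beta> \<phi> \<epsilon>.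
        \<phi> \<in> schwartz \<and> \<epsilon> > 0}"

text \<open>
  A distribution is a HOL function on all of \<open>real^'n \<Rightarrow> complex\<close>. To make equality of distributions
  mean equality on Schwartz functions, distributions are \<open>undefined\<close> at other arguments.
\<close>
type_synonym 'n distribution = "(real^'n \<Rightarrow> complex) \<Rightarrow> complex"

definition tempered :: "'n::finite distribution set" where
  "tempered = {T \<in> extensional schwartz.
     (\<forall>\<phi>\<in>schwartz. \<forall>\<psi>\<in>schwartz. T (\<lambda>x. \<phi> x + \<psi> x) = T \<phi> + T \<psi>) \<and>
     (\<forall>c. \<forall>\<phi>\<in>schwartz. T (\<lambda>x. c * \<phi> x) = c * T \<phi>) \<and>
     continuous_map schwartz_topology euclidean T}"

definition regular_dist :: "(real^'n::finite \<Rightarrow> complex) \<Rightarrow> 'n distribution" where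
  "regular_dist f = (\<lambda>\<phi>\<in>schwartz. \<integral>x. f x * \<phi> x \<partial>lborel)"

definition fourier :: "(real^'n::finite \<Rightarrow> complex) \<Rightarrow> real^'n \<Rightarrow> complex" where
  "fourier \<phi> x = (\<integral>y. \<phi> y * exp (- (\<i> * complex_of_real (x \<bullet> y))) \<partial>lborel)"

definition fourier_dist :: "'n::finite distribution \<Rightarrow> 'n distribution" where
  "fourier_dist T = (\<lambda>\<phi>\<in>schwartz. T (fourier \<phi>))"

definition inv_fourier_dist :: "'n::finite distribution \<Rightarrow> 'n distribution" where
  "inv_fourier_dist = the_inv_into tempered fourier_dist"

text \<open>
  The map \<open>x \<mapsto> (x, 0)\<close>. An index type has no distinguished first \<open>k\<close> elements, so
  the coordinates that carry \<open>x\<close> are specified by an injection \<open>\<iota>\<close> of the index types.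
  Such an injection exists exactly if \<open>k \<le> n\<close>.
\<close>
definition embed :: "('k::finite \<Rightarrow> 'n::finite) \<Rightarrow> real^'k \<Rightarrow> real^'n" where
  "embed \<iota> x = (\<chi> j. if j \<in> range \<iota> then x $ inv \<iota> j else 0)"

lemma embed_index_exists_iff:
  "(\<exists>\<iota>::'k::finite \<Rightarrow> 'n::finite. inj \<iota>) \<longleftrightarrow> CARD('k) \<le> CARD('n)"
  by (metis UNIV_I card_le_inj card_inj_on_le finite subset_UNIV)

lemma embed_nth: "inj \<iota> \<Longrightarrow> embed \<iota> x $ \<iota> i = x $ i"
  by (simp add: embed_def)

lemma embed_nth_outside: "j \<notin> range \<iota> \<Longrightarrow> embed \<iota> x $ j = 0"
  by (simp add: embed_def)

text \<open>
  The tensor product of \<open>g\<close> with the Dirac delta at the origin in the remaining coordinates: \<open>g\<close> is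
  applied to \<open>x \<mapsto> \<langle>\<delta>, \<phi>(x, \<cdot>)\<rangle> = \<phi>(x, 0)\<close>. If \<open>\<iota>\<close> is bijective there are no remaining coordinates.
\<close>
definition tensor_delta ::
    "('k::finite \<Rightarrow> 'n::finite) \<Rightarrow> 'k distribution \<Rightarrow> 'n distribution" where
  "tensor_delta \<iota> g = (\<lambda>\<phi>\<in>schwartz. g (\<lambda>x. \<phi> (embed \<iota> x)))"

definition rotate_dist :: "real^'n^'n::finite \<Rightarrow> 'n distribution \<Rightarrow> 'n distribution" where
  "rotate_dist U g = (\<lambda>\<phi>\<in>schwartz. g (\<lambda>x. \<phi> (transpose U *v x)))"

definition G_family :: "('k::finite \<Rightarrow> 'n::finite) \<Rightarrow> 'n distribution set" where
  "G_family \<iota> = {rotate_dist U (tensor_delta \<iota> (regular_dist f)) | f U.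
     f \<in> schwartz \<and> orthogonal_matrix U}"

definition F_family :: "'k::finite itself \<Rightarrow> 'n::finite distribution set" where
  "F_family _ = {regular_dist (\<lambda>x. f (U *v x)) | (f :: real^'k \<Rightarrow> complex) (U :: real^'n^'k).
     f \<in> schwartz \<and> rank U = CARD('k)}"

end

theory Submission
  imports Defs "HOL-Probability.Characteristic_Functions"
begin

text \<open>
  Let \<open>P\<close> be the \<open>k \<times> n\<close> matrix whose rows are the rows of \<open>U\<close> with indices in the range of \<open>\<iota>\<close>.
  Its rows are orthonormal, and \<open>(T\<^sub>f \<otimes> \<delta>)\<^sub>U\<close> integrates \<open>f\<close> against the restriction of a test function to
  the \<open>k\<close>-dimensional subspace parametrised by the adjoint \<open>P\<^sup>T\<close>. Since
  \<open>\<langle>P\<^sup>T x, y\<rangle> = \<langle>x, P y\<rangle>\<close>, Fubini's theorem moves the Fourier transform from the test function to \<open>f\<close>: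
  \<open>\<integral> f(x) F\<phi>(P\<^sup>T x) dx = \<integral> Ff(P y) \<phi>(y) dy\<close>. Hence the Fourier transform of
  \<open>(T\<^sub>f \<otimes> \<delta>)\<^sub>U\<close> is the regular distribution of \<open>Ff \<circ> P\<close>
  (\<open>fourier_dist_rotate_tensor_delta\<close>). As \<open>Ff\<close> is a Schwartz function and \<open>P\<close> has rank \<open>k\<close>, it lies in
  the second family.

  Conversely, extend an orthonormal basis of the row space of a matrix \<open>B\<close> of rank \<open>k\<close> to an
  orthonormal basis of the whole space. This writes \<open>B = C P\<close> with \<open>C\<close> invertible and \<open>P\<close> as above
  (\<open>full_rank_factorization\<close>). For a Schwartz function \<open>f\<close> the function \<open>f \<circ> C\<close> is again a Schwartz
  function, so it is \<open>Fg\<close> for some Schwartz function \<open>g\<close> (\<open>fourier_surj_schwartz\<close>), and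
  \<open>f(B x) = Fg(P x)\<close>.

  The second equation follows from the first because the Fourier transform is injective on tempered
  distributions (again by surjectivity on Schwartz functions) and the first family consists of
  tempered distributions.

  What has to be developed for this is the Fourier transform on Schwartz functions of several
  variables. Every membership in the Schwartz space is shown by coinduction: a set of rapidly
  decreasing differentiable functions whose partial derivatives are linear combinations of elements of
  the set consists of Schwartz functions (\<open>schwartz_coinduct_span\<close>). The inversion formula
  is obtained from a Gaussian \<open>g\<close>: dilation shows \<open>g(0) \<integral> F\<phi> = \<phi>(0) \<integral> Fg\<close>, which is inversion at the
  origin, and translation gives all other points. The constant does not vanish because \<open>Fg\<close>
  and \<open>g\<close> satisfy the same first-order differential equation, so that \<open>Fg\<close> is a positive
  multiple of \<open>g\<close>.
\<close>

section \<open>Rapidly decreasing functions\<close>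

text \<open>
  A single weight \<open>(1 + \<bar>x\<bar>)\<^sup>N\<close> replaces the monomials in the bounds that define Schwartz functions. In
  contrast to monomials it behaves well under linear changes of variables.
\<close>
definition rapidly_decreasing :: "('a::real_normed_vector \<Rightarrow> complex) \<Rightarrow> bool" where
  "rapidly_decreasing f \<longleftrightarrow> (\<forall>N::nat. \<exists>C. \<forall>x. (1 + norm x) ^ N * norm (f x) \<le> C)"

lemma rapidly_decreasingD:
  assumes "rapidly_decreasing f"
  obtains C where "C \<ge> 0" "\<And>x. (1 + norm x) ^ N * norm (f x) \<le> C"
proof -
  obtain C where "\<And>x. (1 + norm x) ^ N * norm (f x) \<le> C"
    using assms unfolding rapidly_decreasing_def by blast
  moreover from this[of 0] have "C \<ge> 0"
    by (metis norm_ge_zero norm_zero add_0_right mult_1 order_trans power_one)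
  ultimately show ?thesis using that by blast
qed

lemma rapidly_decreasing_bound:
  assumes "rapidly_decreasing f"
  obtains C where "C \<ge> 0" "\<And>x. norm (f x) \<le> C / (1 + norm x) ^ N"
proof -
  obtain C where "C \<ge> 0" and C: "\<And>x. (1 + norm x) ^ N * norm (f x) \<le> C"
    using rapidly_decreasingD[OF assms] by blast
  have "norm (f x) \<le> C / (1 + norm x) ^ N" for x
  proof -
    have "1 + norm x > 0"
      by (simp add: add_pos_nonneg)
    then show ?thesis
      using C[of x] by (simp add: pos_le_divide_eq mult.commute)
  qed
  with \<open>C \<ge> 0\<close> show ?thesis by (rule that)
qed

lemma rapidly_decreasing_add:
  assumes "rapidly_decreasing f" "rapidly_decreasing g"
  shows "rapidly_decreasing (\<lambda>x. f x + g x)"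
  unfolding rapidly_decreasing_def
proof
  fix N
  obtain C where C: "\<And>x. (1 + norm x) ^ N * norm (f x) \<le> C"
    using rapidly_decreasingD[OF assms(1)] by blast
  obtain D where D: "\<And>x. (1 + norm x) ^ N * norm (g x) \<le> D"
    using rapidly_decreasingD[OF assms(2)] by blast
  have "(1 + norm x) ^ N * norm (f x + g x) \<le> C + D" for x
  proof -
    have "(1 + norm x) ^ N * norm (f x + g x) \<le> (1 + norm x) ^ N * (norm (f x) + norm (g x))"
      by (intro mult_left_mono norm_triangle_ineq) (simp add: add_nonneg_nonneg)
    then show ?thesis
      using C[of x] D[of x] by (simp add: distrib_left)
  qed
  then show "\<exists>C. \<forall>x. (1 + norm x) ^ N * norm (f x + g x) \<le> C" by blast
qed

lemma rapidly_decreasing_polynomial_mult: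
  fixes p f :: "'a::real_normed_vector \<Rightarrow> complex"
  assumes f: "rapidly_decreasing f"
    and p: "\<And>x. norm (p x) \<le> K * (1 + norm x) ^ M"
  shows "rapidly_decreasing (\<lambda>x. p x * f x)"
  unfolding rapidly_decreasing_def
proof
  fix N
  obtain C where C: "\<And>x. (1 + norm x) ^ (N + M) * norm (f x) \<le> C"
    using rapidly_decreasingD[OF f] by blast
  have K: "K \<ge> 0"
    using order_trans[OF norm_ge_zero p[of 0]] by simp
  have "(1 + norm x) ^ N * norm (p x * f x) \<le> K * C" for x
  proof -
    have "(1 + norm x) ^ N * norm (p x * f x)
      = norm (p x) * ((1 + norm x) ^ N * norm (f x))"
      by (simp add: norm_mult)
    also have "\<dots> \<le> (K * (1 + norm x) ^ M) * ((1 + norm x) ^ N * norm (f x))"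
      by (intro mult_right_mono p) (simp add: add_nonneg_nonneg)
    also have "\<dots> = K * ((1 + norm x) ^ (N + M) * norm (f x))"
      by (simp add: power_add)
    also have "\<dots> \<le> K * C"
      by (intro mult_left_mono C K)
    finally show ?thesis .
  qed
  then show "\<exists>C. \<forall>x. (1 + norm x) ^ N * norm (p x * f x) \<le> C" by blast
qed

text \<open>
  An injective linear map is bounded below, so \<open>1 + \<bar>x\<bar>\<close> is at most a constant times \<open>1 + \<bar>A x + b\<bar>\<close>.
\<close>
lemma rapidly_decreasing_affine:
  fixes f :: "real^'n::finite \<Rightarrow> complex" and A :: "real^'m::finite \<Rightarrow> real^'n"
  assumes f: "rapidly_decreasing f" and A: "linear A" "inj A"
  shows "rapidly_decreasing (\<lambda>x. f (A x + b))"
  unfolding rapidly_decreasing_def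
proof
  fix N
  obtain C where "C \<ge> 0" and C: "\<And>x. (1 + norm x) ^ N * norm (f x) \<le> C"
    using rapidly_decreasingD[OF f] by blast
  obtain K where "K > 0" and K: "\<And>x. K * norm x \<le> norm (A x)"
    using linear_inj_bounded_below_pos[OF A] by blast
  (* norm x is at most (norm (A x + b) + norm b) / K, hence at most q * (1 + norm (A x + b)). *)
  define q where "q = (1 + norm b) / K"
  define M where "M = 1 + q"
  have "q \<ge> 0"
    using \<open>K > 0\<close> by (simp add: q_def)
  have M: "1 + norm x \<le> M * (1 + norm (A x + b))" for x
  proof -
    have "K * norm x \<le> norm (A x + b) + norm b"
      using K[of x] norm_triangle_ineq4[of "A x + b" b] by simp
    then have "norm x \<le> (norm (A x + b) + norm b) / K"
      using \<open>K > 0\<close> by (simp add: pos_le_divide_eq mult.commute)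
    also have "\<dots> \<le> ((1 + norm b) * (1 + norm (A x + b))) / K"
      using \<open>K > 0\<close> by (intro divide_right_mono) (simp_all add: algebra_simps)
    finally have "norm x \<le> q * (1 + norm (A x + b))"
      by (simp add: q_def)
    then show ?thesis
      unfolding M_def distrib_right mult_1_left using norm_ge_zero[of "A x + b"] by linarith
  qed
  have "(1 + norm x) ^ N * norm (f (A x + b)) \<le> M ^ N * C" for x
  proof -
    have "(1 + norm x) ^ N \<le> (M * (1 + norm (A x + b))) ^ N"
      by (intro power_mono M) (simp add: add_nonneg_nonneg)
    then have "(1 + norm x) ^ N * norm (f (A x + b))
      \<le> (M * (1 + norm (A x + b))) ^ N * norm (f (A x + b))"
      by (intro mult_right_mono) auto
    also have "\<dots> = M ^ N * ((1 + norm (A x + b)) ^ N * norm (f (A x + b)))"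
      by (simp add: power_mult_distrib)
    also have "\<dots> \<le> M ^ N * C"
      using \<open>q \<ge> 0\<close> by (intro mult_left_mono C) (simp add: M_def)
    finally show ?thesis .
  qed
  then show "\<exists>C. \<forall>x. (1 + norm x) ^ N * norm (f (A x + b)) \<le> C" by blast
qed

lemma abs_monomial_le: "\<bar>monomial \<alpha> x\<bar> \<le> (1 + norm x) ^ (\<Sum>i\<in>UNIV. \<alpha> i)"
proof -
  have "\<bar>monomial \<alpha> x\<bar> = (\<Prod>i\<in>UNIV. \<bar>x $ i\<bar> ^ \<alpha> i)"
    by (simp add: monomial_def abs_prod power_abs)
  also have "\<dots> \<le> (\<Prod>i\<in>UNIV. (1 + norm x) ^ \<alpha> i)"
    by (intro prod_mono conjI power_mono) (use component_le_norm_cart[of x] in \<open>simp_all add: add_increasing\<close>)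
  finally show ?thesis
    by (simp add: power_sum)
qed

text \<open>
  The norm is at most \<open>n\<close> times the largest coordinate \<open>m\<close>. If \<open>m \<le> 1\<close> the constant summand suffices,
  otherwise the summand of that coordinate does.
\<close>
lemma power_norm_le_sum_coordinates:
  fixes x :: "real^'n::finite"
  shows "(1 + norm x) ^ N \<le> (1 + real CARD('n)) ^ N * (1 + (\<Sum>i\<in>UNIV. \<bar>x $ i\<bar> ^ N))"
proof -
  define m where "m = Max (range (\<lambda>i. \<bar>x $ i\<bar>))"
  have "m \<in> range (\<lambda>i. \<bar>x $ i\<bar>)"
    unfolding m_def by (intro Max_in) auto
  then obtain i where i: "m = \<bar>x $ i\<bar>" by blast
  have "\<bar>x $ j\<bar> \<le> m" for j
    unfolding m_def by (intro Max_ge) auto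
  then have "(\<Sum>j\<in>UNIV. \<bar>x $ j\<bar>) \<le> real CARD('n) * m"
    using sum_bounded_above[of UNIV "\<lambda>j. \<bar>x $ j\<bar>" m] by simp
  then have n: "norm x \<le> real CARD('n) * m"
    using norm_le_l1_cart[of x] by simp
  have m0: "m \<ge> 0" by (simp add: i)
  have im: "m ^ N \<le> (\<Sum>j\<in>UNIV. \<bar>x $ j\<bar> ^ N)"
    unfolding i by (rule member_le_sum) auto
  show ?thesis
  proof (cases "m \<le> 1")
    case True
    then have "1 + norm x \<le> 1 + real CARD('n)"
      using n mult_left_mono[OF True, of "real CARD('n)"] by linarith
    then have "(1 + norm x) ^ N \<le> (1 + real CARD('n)) ^ N * 1"
      by (simp add: power_mono)
    also have "\<dots> \<le> (1 + real CARD('n)) ^ N * (1 + (\<Sum>i\<in>UNIV. \<bar>x $ i\<bar> ^ N))"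
      by (intro mult_left_mono) (auto intro: sum_nonneg)
    finally show ?thesis .
  next
    case False
    then have "1 + norm x \<le> (1 + real CARD('n)) * m"
      using n by (simp add: algebra_simps)
    then have "(1 + norm x) ^ N \<le> ((1 + real CARD('n)) * m) ^ N"
      by (simp add: power_mono)
    also have "\<dots> = (1 + real CARD('n)) ^ N * m ^ N"
      by (simp add: power_mult_distrib)
    also have "\<dots> \<le> (1 + real CARD('n)) ^ N * (1 + (\<Sum>i\<in>UNIV. \<bar>x $ i\<bar> ^ N))"
      using im by (intro mult_left_mono) auto
    finally show ?thesis .
  qed
qed

lemma rapidly_decreasing_iff_monomial:
  fixes f :: "real^'n::finite \<Rightarrow> complex"
  shows "rapidly_decreasing f \<longleftrightarrow> (\<forall>\<alpha>. bounded (range (\<lambda>x. monomial \<alpha> x *\<^sub>R f x)))"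
proof (intro iffI allI)
  fix \<alpha> :: "'n \<Rightarrow> nat"
  assume "rapidly_decreasing f"
  then obtain C where C: "\<And>x. (1 + norm x) ^ (\<Sum>i\<in>UNIV. \<alpha> i) * norm (f x) \<le> C"
    using rapidly_decreasingD by blast
  have "norm (monomial \<alpha> x *\<^sub>R f x) \<le> C" for x
    using mult_right_mono[OF abs_monomial_le[of \<alpha> x] norm_ge_zero[of "f x"]] C[of x] by simp
  then show "bounded (range (\<lambda>x. monomial \<alpha> x *\<^sub>R f x))"
    by (auto simp: bounded_iff)
next
  assume bdd: "\<forall>\<alpha>. bounded (range (\<lambda>x. monomial \<alpha> x *\<^sub>R f x))"
  have mono: "\<exists>C. \<forall>x. \<bar>x $ i\<bar> ^ N * norm (f x) \<le> C" for i N
  proof -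
    have "monomial (\<lambda>j. if j = i then N else 0) x = (x $ i) ^ N" for x :: "real^'n"
    proof -
      have "monomial (\<lambda>j. if j = i then N else 0) x = (\<Prod>j\<in>UNIV. if j = i then (x $ i) ^ N else 1)"
        unfolding monomial_def by (rule prod.cong) auto
      then show ?thesis by simp
    qed
    then show ?thesis
      using bdd[rule_format, of "\<lambda>j. if j = i then N else 0"] by (auto simp: bounded_iff power_abs)
  qed
  have const: "\<exists>C. \<forall>x. norm (f x) \<le> C"
    using mono[of undefined 0] by simp
  show "rapidly_decreasing f"
    unfolding rapidly_decreasing_def
  proof
    fix N
    obtain C where C: "\<And>i x. \<bar>x $ i\<bar> ^ N * norm (f x) \<le> C i"
      using mono[of _ N] by metis
    obtain D where D: "\<And>x. norm (f x) \<le> D"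
      using const by blast
    let ?K = "(1 + real CARD('n)) ^ N"
    have "(1 + norm x) ^ N * norm (f x) \<le> ?K * (D + (\<Sum>i\<in>UNIV. C i))" for x
    proof -
      have "(1 + norm x) ^ N * norm (f x) \<le> ?K * (1 + (\<Sum>i\<in>UNIV. \<bar>x $ i\<bar> ^ N)) * norm (f x)"
        by (intro mult_right_mono power_norm_le_sum_coordinates) auto
      also have "\<dots> = ?K * (norm (f x) + (\<Sum>i\<in>UNIV. \<bar>x $ i\<bar> ^ N * norm (f x)))"
        by (simp add: algebra_simps sum_distrib_left)
      also have "\<dots> \<le> ?K * (D + (\<Sum>i\<in>UNIV. C i))"
        by (intro mult_left_mono add_mono sum_mono C D) auto
      finally show ?thesis .
    qed
    then show "\<exists>C. \<forall>x. (1 + norm x) ^ N * norm (f x) \<le> C" by blast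
  qed
qed

section \<open>Coinduction for Schwartz functions\<close>

lemma partial_deriv_eq:
  assumes "(f has_derivative D) (at x)"
  shows "partial_deriv i f x = D (axis i 1)"
  unfolding partial_deriv_def frechet_derivative_at[OF assms, symmetric] ..

lemma has_derivative_partial_deriv:
  fixes f :: "real^'n::finite \<Rightarrow> complex"
  assumes "f differentiable (at x)"
  shows "(f has_derivative (\<lambda>h. \<Sum>i\<in>UNIV. h $ i *\<^sub>R partial_deriv i f x)) (at x)"
proof -
  from assms obtain D where D: "(f has_derivative D) (at x)"
    unfolding differentiable_def by blast
  then have "linear D" by (rule has_derivative_linear)
  have "D h = (\<Sum>i\<in>UNIV. h $ i *\<^sub>R partial_deriv i f x)" for h
  proof -
    have "D h = D (\<Sum>i\<in>UNIV. h $ i *\<^sub>R axis i 1)"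
      using basis_expansion[of h] by (simp add: scalar_mult_eq_scaleR)
    also have "\<dots> = (\<Sum>i\<in>UNIV. h $ i *\<^sub>R D (axis i 1))"
      by (simp add: linear_sum[OF \<open>linear D\<close>] linear_cmul[OF \<open>linear D\<close>])
    finally show ?thesis
      by (simp add: partial_deriv_eq[OF D])
  qed
  then have "D = (\<lambda>h. \<Sum>i\<in>UNIV. h $ i *\<^sub>R partial_deriv i f x)" by blast
  with D show ?thesis by simp
qed

lemma schwartz_iff:
  "\<phi> \<in> schwartz \<longleftrightarrow>
     (\<forall>\<beta>. partial_derivs \<beta> \<phi> differentiable_on UNIV \<and> rapidly_decreasing (partial_derivs \<beta> \<phi>))"
  by (auto simp: schwartz_def smooth_def rapidly_decreasing_iff_monomial)

lemma schwartz_differentiable: "\<phi> \<in> schwartz \<Longrightarrow> \<phi> differentiable (at x)"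
  by (auto simp: schwartz_iff partial_derivs_def differentiable_on_def dest: spec[of _ "[]"])

lemma schwartz_rapidly_decreasing: "\<phi> \<in> schwartz \<Longrightarrow> rapidly_decreasing \<phi>"
  by (auto simp: schwartz_iff partial_derivs_def dest: spec[of _ "[]"])

lemma schwartz_partial_deriv:
  assumes "\<phi> \<in> schwartz"
  shows "partial_deriv i \<phi> \<in> schwartz"
proof -
  have "partial_derivs \<beta> (partial_deriv i \<phi>) = partial_derivs (\<beta> @ [i]) \<phi>" for \<beta>
    by (simp add: partial_derivs_def)
  then show ?thesis
    using assms by (simp add: schwartz_iff)
qed

lemma schwartz_has_derivative:
  "\<phi> \<in> schwartz \<Longrightarrow> (\<phi> has_derivative (\<lambda>h. \<Sum>i\<in>UNIV. h $ i *\<^sub>R partial_deriv i \<phi> x)) (at x)"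
  by (intro has_derivative_partial_deriv schwartz_differentiable)

text \<open>
  The Schwartz space is the largest set of rapidly decreasing differentiable functions that is closed under
  partial derivatives. The derivative is given by a witness \<open>D\<close>, so that in applications it can be
  computed by the usual rules instead of being extracted from \<^const>\<open>frechet_derivative\<close>.
\<close>
lemma schwartz_coinduct [consumes 1, case_names rapidly_decreasing derivative]:
  assumes "\<phi> \<in> S"
    and rapid: "\<And>\<psi>. \<psi> \<in> S \<Longrightarrow> rapidly_decreasing \<psi>"
    and deriv: "\<And>\<psi>. \<psi> \<in> S \<Longrightarrow>
      \<exists>D. (\<forall>x. (\<psi> has_derivative D x) (at x)) \<and> (\<forall>i. (\<lambda>x. D x (axis i 1)) \<in> S)"
  shows "\<phi> \<in> schwartz"
proof -
  have "partial_derivs \<beta> \<phi> \<in> S" for \<beta>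
  proof (induction \<beta>)
    case Nil
    then show ?case using assms(1) by (simp add: partial_derivs_def)
  next
    case (Cons i \<beta>)
    from deriv[OF Cons.IH] obtain D where D: "\<And>x. (partial_derivs \<beta> \<phi> has_derivative D x) (at x)"
      "(\<lambda>x. D x (axis i 1)) \<in> S" by blast
    have "partial_derivs (i # \<beta>) \<phi> = (\<lambda>x. D x (axis i 1))"
      by (rule ext) (simp add: partial_derivs_def partial_deriv_eq[OF D(1), unfolded partial_derivs_def])
    with D(2) show ?case by simp
  qed
  then show ?thesis
    unfolding schwartz_iff
    by (meson deriv differentiable_at_imp_differentiable_on differentiable_def rapid)
qed

text \<open>
  The complex linear span, as a set of functions: coinduction up to linear combinations needs only
  closure properties and an induction rule.
\<close>
inductive_set complex_span :: "('a \<Rightarrow> complex) set \<Rightarrow> ('a \<Rightarrow> complex) set"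
  for S :: "('a \<Rightarrow> complex) set" where
  zero: "(\<lambda>x. 0) \<in> complex_span S"
| base: "f \<in> S \<Longrightarrow> f \<in> complex_span S"
| add: "f \<in> complex_span S \<Longrightarrow> g \<in> complex_span S \<Longrightarrow> (\<lambda>x. f x + g x) \<in> complex_span S"
| scale: "f \<in> complex_span S \<Longrightarrow> (\<lambda>x. c * f x) \<in> complex_span S"

lemma complex_span_sum:
  assumes "\<And>i. i \<in> I \<Longrightarrow> f i \<in> complex_span S"
  shows "(\<lambda>x. \<Sum>i\<in>I. f i x) \<in> complex_span S"
  using assms
  by (induction I rule: infinite_finite_induct) (auto intro: complex_span.intros)

text \<open>
  Coinduction up to linear combinations. By the product and chain rules the derivatives of
  \<open>x\<^sub>j \<psi>\<close> or \<open>\<psi> \<circ> A\<close> are sums of functions of this form, so the coinductive set only has to contain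
  the functions themselves.
\<close>
lemma schwartz_coinduct_span:
  assumes "\<phi> \<in> complex_span S"
    and rapid: "\<And>\<psi>. \<psi> \<in> S \<Longrightarrow> rapidly_decreasing \<psi>"
    and deriv: "\<And>\<psi>. \<psi> \<in> S \<Longrightarrow>
      \<exists>D. (\<forall>x. (\<psi> has_derivative D x) (at x)) \<and> (\<forall>i. (\<lambda>x. D x (axis i 1)) \<in> complex_span S)"
  shows "\<phi> \<in> schwartz"
  using assms(1)
proof (rule schwartz_coinduct)
  fix \<psi> assume "\<psi> \<in> complex_span S"
  then show "rapidly_decreasing \<psi>"
  proof induction
    case zero
    then show ?case by (auto simp: rapidly_decreasing_def)
  next
    case (scale f c)
    then show ?case
      using rapidly_decreasing_polynomial_mult[of f "\<lambda>_. c" "norm c" 0] by simp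
  qed (auto intro: rapid rapidly_decreasing_add)
next
  fix \<psi> assume "\<psi> \<in> complex_span S"
  then show "\<exists>D. (\<forall>x. (\<psi> has_derivative D x) (at x)) \<and> (\<forall>i. (\<lambda>x. D x (axis i 1)) \<in> complex_span S)"
  proof induction
    case zero
    then show ?case
      by (intro exI[of _ "\<lambda>x h. 0"]) (auto intro: complex_span.zero)
  next
    case (base f)
    then show ?case by (rule deriv)
  next
    case (add f g)
    then obtain D E where "\<forall>x. (f has_derivative D x) (at x)" "\<forall>x. (g has_derivative E x) (at x)"
      "\<forall>i. (\<lambda>x. D x (axis i 1)) \<in> complex_span S" "\<forall>i. (\<lambda>x. E x (axis i 1)) \<in> complex_span S"
      by blast
    then show ?case
      by (intro exI[of _ "\<lambda>x h. D x h + E x h"]) (auto intro: has_derivative_add complex_span.add)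
  next
    case (scale f c)
    then obtain D where "\<forall>x. (f has_derivative D x) (at x)"
      "\<forall>i. (\<lambda>x. D x (axis i 1)) \<in> complex_span S"
      by blast
    then show ?case
      by (intro exI[of _ "\<lambda>x h. c * D x h"]) (auto intro: has_derivative_mult_right complex_span.scale)
  qed
qed

lemma sum_axis_scaleR [simp]:
  "(\<Sum>j\<in>UNIV. axis i (1::real) $ j *\<^sub>R f j) = (f i :: 'a::real_vector)"
proof -
  have "(\<Sum>j\<in>UNIV. axis i (1::real) $ j *\<^sub>R f j) = (\<Sum>j\<in>UNIV. if j = i then f j else 0)"
    by (rule sum.cong) (auto simp: axis_def)
  then show ?thesis by simp
qed

lemma complex_span_schwartz:
  assumes "\<phi> \<in> complex_span schwartz"
  shows "\<phi> \<in> schwartz"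
  using assms
proof (rule schwartz_coinduct_span)
  fix \<psi> :: "real^'a \<Rightarrow> complex"
  assume \<psi>: "\<psi> \<in> schwartz"
  show "\<exists>D. (\<forall>x. (\<psi> has_derivative D x) (at x)) \<and> (\<forall>i. (\<lambda>x. D x (axis i 1)) \<in> complex_span schwartz)"
    by (intro exI[of _ "\<lambda>x h. \<Sum>i\<in>UNIV. h $ i *\<^sub>R partial_deriv i \<psi> x"])
       (auto intro: schwartz_has_derivative \<psi> complex_span.base schwartz_partial_deriv)
qed (rule schwartz_rapidly_decreasing)

lemma schwartz_add:
  "\<phi> \<in> schwartz \<Longrightarrow> \<psi> \<in> schwartz \<Longrightarrow> (\<lambda>x. \<phi> x + \<psi> x) \<in> schwartz"
  by (rule complex_span_schwartz) (intro complex_span.add complex_span.base)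

lemma schwartz_cmult: "\<phi> \<in> schwartz \<Longrightarrow> (\<lambda>x. c * \<phi> x) \<in> schwartz"
  by (rule complex_span_schwartz) (intro complex_span.scale complex_span.base)

lemma schwartz_coordinate_mult:
  fixes \<phi> :: "real^'n::finite \<Rightarrow> complex"
  assumes "\<phi> \<in> schwartz"
  shows "(\<lambda>x. complex_of_real (x $ j) * \<phi> x) \<in> schwartz"
proof -
  let ?S = "{\<lambda>x. complex_of_real (x $ j) * \<psi> x | \<psi>. \<psi> \<in> schwartz} \<union> schwartz"
  show ?thesis
  proof (rule schwartz_coinduct_span)
    show "(\<lambda>x. complex_of_real (x $ j) * \<phi> x) \<in> complex_span ?S"
      using assms by (intro complex_span.base) blast
  next
    fix \<psi> assume "\<psi> \<in> ?S"
    moreover have "rapidly_decreasing (\<lambda>x. complex_of_real (x $ j) * f x)" if "f \<in> schwartz" for f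
    proof (rule rapidly_decreasing_polynomial_mult)
      show "rapidly_decreasing f"
        using that by (rule schwartz_rapidly_decreasing)
      show "norm (complex_of_real (x $ j)) \<le> 1 * (1 + norm x) ^ 1" for x :: "real^'n"
        using component_le_norm_cart[of x j] by simp
    qed
    ultimately show "rapidly_decreasing \<psi>"
      by (auto intro: schwartz_rapidly_decreasing)
  next
    fix \<psi> assume "\<psi> \<in> ?S"
    then consider f where "f \<in> schwartz" "\<psi> = (\<lambda>x. complex_of_real (x $ j) * f x)" | "\<psi> \<in> schwartz"
      by blast
    then show "\<exists>D. (\<forall>x. (\<psi> has_derivative D x) (at x)) \<and> (\<forall>i. (\<lambda>x. D x (axis i 1)) \<in> complex_span ?S)"
    proof cases
      case 1
      let ?D = "\<lambda>x h. \<Sum>i\<in>UNIV. h $ i *\<^sub>R partial_deriv i f x"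
      have "((\<lambda>x. complex_of_real (x $ j)) has_derivative (\<lambda>h. complex_of_real (h $ j))) (at x)" for x :: "real^'n"
        by (rule bounded_linear_imp_has_derivative)
           (rule bounded_linear_compose[OF bounded_linear_of_real bounded_linear_vec_nth])
      then have "(\<psi> has_derivative (\<lambda>h. complex_of_real (x $ j) * ?D x h + complex_of_real (h $ j) * f x)) (at x)" for x
        unfolding 1(2) by (intro has_derivative_mult schwartz_has_derivative[OF 1(1)])
      moreover have "(\<lambda>x. complex_of_real (x $ j) * partial_deriv i f x + complex_of_real (axis i 1 $ j) * f x)
          \<in> complex_span ?S" for i
        using schwartz_partial_deriv[OF 1(1), of i] 1(1)
        by (intro complex_span.add complex_span.scale complex_span.base) auto
      ultimately show ?thesis
        by (intro exI[of _ "\<lambda>x h. complex_of_real (x $ j) * ?D x h + complex_of_real (h $ j) * f x"]) simp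
    next
      case 2
      then show ?thesis
        by (intro exI[of _ "\<lambda>x h. \<Sum>i\<in>UNIV. h $ i *\<^sub>R partial_deriv i \<psi> x"])
           (auto intro: schwartz_has_derivative complex_span.base schwartz_partial_deriv)
    qed
  qed
qed

lemma schwartz_affine:
  fixes \<phi> :: "real^'n::finite \<Rightarrow> complex" and A :: "real^'m::finite \<Rightarrow> real^'n"
  assumes "\<phi> \<in> schwartz" and A: "linear A" "inj A"
  shows "(\<lambda>x. \<phi> (A x + b)) \<in> schwartz"
proof -
  let ?S = "{\<lambda>x. \<psi> (A x + b) | \<psi>. \<psi> \<in> schwartz}"
  show ?thesis
  proof (rule schwartz_coinduct_span)
    show "(\<lambda>x. \<phi> (A x + b)) \<in> complex_span ?S"
      using assms by (intro complex_span.base) blast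
  next
    fix \<psi> assume "\<psi> \<in> ?S"
    then show "rapidly_decreasing \<psi>"
      by (auto intro: rapidly_decreasing_affine A schwartz_rapidly_decreasing)
  next
    fix \<psi> assume "\<psi> \<in> ?S"
    then obtain f where f: "f \<in> schwartz" and \<psi>: "\<psi> = (\<lambda>x. f (A x + b))"
      by blast
    let ?D = "\<lambda>x h. \<Sum>i\<in>UNIV. A h $ i *\<^sub>R partial_deriv i f (A x + b)"
    have "(A has_derivative A) (at x)" for x
      by (intro bounded_linear_imp_has_derivative linear_conv_bounded_linear[THEN iffD1] A)
    then have "((\<lambda>x. A x + b) has_derivative (\<lambda>h. A h + 0)) (at x)" for x
      by (intro has_derivative_add has_derivative_const)
    then have "((\<lambda>x. A x + b) has_derivative A) (at x)" for x
      by simp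
    from has_derivative_compose[OF this schwartz_has_derivative[OF f]]
    have "(\<psi> has_derivative ?D x) (at x)" for x
      unfolding \<psi> .
    moreover have "(\<lambda>x. ?D x (axis i 1)) \<in> complex_span ?S" for i
      unfolding scaleR_conv_of_real
      by (intro complex_span_sum complex_span.scale complex_span.base)
         (auto intro: schwartz_partial_deriv f)
    ultimately show "\<exists>D. (\<forall>x. (\<psi> has_derivative D x) (at x)) \<and> (\<forall>i. (\<lambda>x. D x (axis i 1)) \<in> complex_span ?S)"
      by (intro exI[of _ ?D]) simp
  qed
qed

lemma schwartz_linear:
  fixes \<phi> :: "real^'n::finite \<Rightarrow> complex" and A :: "real^'m::finite \<Rightarrow> real^'n"
  shows "\<phi> \<in> schwartz \<Longrightarrow> linear A \<Longrightarrow> inj A \<Longrightarrow> (\<lambda>x. \<phi> (A x)) \<in> schwartz"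
  using schwartz_affine[of \<phi> A 0] by simp

lemma schwartz_translate: "\<phi> \<in> schwartz \<Longrightarrow> (\<lambda>x. \<phi> (x + b)) \<in> schwartz"
  using schwartz_affine[of \<phi> "\<lambda>x. x" b] by (simp add: inj_on_def linear_iff)

section \<open>Integrals of Schwartz functions\<close>

lemma schwartz_continuous: "\<phi> \<in> schwartz \<Longrightarrow> continuous_on UNIV \<phi>"
  by (simp add: continuous_at_imp_continuous_on differentiable_imp_continuous_within schwartz_differentiable)

lemma schwartz_measurable: "\<phi> \<in> schwartz \<Longrightarrow> \<phi> \<in> borel_measurable borel"
  by (intro borel_measurable_continuous_onI schwartz_continuous)

lemma schwartz_bounded:
  assumes "\<phi> \<in> schwartz"
  obtains C where "C \<ge> 0" "\<And>x. norm (\<phi> x) \<le> C"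
  using rapidly_decreasingD[OF schwartz_rapidly_decreasing[OF assms], of 0] by auto

text \<open>
  On the shell \<open>k \<le> \<bar>x\<bar> < k + 1\<close> the function is at most \<open>(k + 1)\<^bsup>-(d+2)\<^esup>\<close>, and the ball of radius \<open>k + 1\<close>
  has volume proportional to \<open>(k + 1)\<^sup>d\<close>. So the integral is bounded by a multiple of \<open>\<Sum> 1 / (k + 1)\<^sup>2\<close>.
\<close>
lemma integrable_inverse_power_norm:
  "integrable lborel (\<lambda>x::'a::euclidean_space. 1 / (1 + norm x) ^ (DIM('a) + 2))"
proof (rule integrableI_bounded)
  show "(\<lambda>x::'a. 1 / (1 + norm x) ^ (DIM('a) + 2)) \<in> borel_measurable lborel"
    by measurable
  let ?d = "DIM('a)"
  let ?a = "\<lambda>k. 1 / real (Suc k) ^ (?d + 2)"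
  let ?V = "unit_ball_vol (real ?d)"
  have pointwise: "ennreal (norm (1 / (1 + norm x) ^ (?d + 2)))
      \<le> (\<Sum>k. ennreal (?a k) * indicator (ball 0 (real (Suc k))) x)" for x :: 'a
  proof -
    define k where "k = nat \<lfloor>norm x\<rfloor>"
    have k: "real k \<le> norm x" "norm x < real (Suc k)"
      unfolding k_def by (simp_all add: of_nat_nat) linarith+
    have "real (Suc k) ^ (?d + 2) \<le> (1 + norm x) ^ (?d + 2)"
      using k(1) by (intro power_mono) auto
    then have "1 / (1 + norm x) ^ (?d + 2) \<le> ?a k"
      by (intro divide_left_mono mult_pos_pos zero_less_power) (auto intro: add_pos_nonneg)
    then have "norm (1 / (1 + norm x) ^ (?d + 2)) \<le> ?a k"
      by (simp only: real_norm_def abs_of_nonneg zero_le_divide_1_iff zero_le_power norm_ge_zero add_nonneg_nonneg zero_le_one)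
    then have "ennreal (norm (1 / (1 + norm x) ^ (?d + 2)))
        \<le> ennreal (?a k) * indicator (ball 0 (real (Suc k))) x"
      using k(2) by (simp add: ennreal_leI)
    also have "\<dots> \<le> (\<Sum>k. ennreal (?a k) * indicator (ball 0 (real (Suc k))) x)"
    proof -
      have "f k \<le> (\<Sum>k. f k)" for f :: "nat \<Rightarrow> ennreal"
        using sum_le_suminf[OF summableI, of "{k}" f] by simp
      then show ?thesis .
    qed
    finally show ?thesis .
  qed
  have summ: "summable (\<lambda>k. 1 / real (Suc k) ^ 2)"
    using inverse_power_summable[of 2, where ?'a = real] summable_Suc_iff[of "\<lambda>n. inverse (real n ^ 2)"]
    by (simp add: inverse_eq_divide del: of_nat_Suc)
  have "(\<integral>\<^sup>+x. ennreal (norm (1 / (1 + norm (x::'a)) ^ (?d + 2))) \<partial>lborel)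
    \<le> (\<integral>\<^sup>+x. (\<Sum>k. ennreal (?a k) * indicator (ball (0::'a) (real (Suc k))) x) \<partial>lborel)"
    by (intro nn_integral_mono pointwise)
  also have "\<dots> = (\<Sum>k. \<integral>\<^sup>+x. ennreal (?a k) * indicator (ball (0::'a) (real (Suc k))) x \<partial>lborel)"
    by (rule nn_integral_suminf)
       (intro borel_measurable_times_ennreal borel_measurable_const borel_measurable_indicator, simp)
  also have "\<dots> = (\<Sum>k. ennreal (?V * (1 / real (Suc k) ^ 2)))"
  proof (rule suminf_cong)
    fix k
    have "(\<integral>\<^sup>+x. ennreal (?a k) * indicator (ball (0::'a) (real (Suc k))) x \<partial>lborel)
      = ennreal (?a k) * emeasure lborel (ball (0::'a) (real (Suc k)))"
      by (rule nn_integral_cmult_indicator) simp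
    also have "\<dots> = ennreal (?a k * (?V * real (Suc k) ^ ?d))"
      by (subst emeasure_ball, simp, subst ennreal_mult[symmetric]) auto
    also have "?a k * (?V * real (Suc k) ^ ?d) = ?V * (1 / real (Suc k) ^ 2)"
      by (simp add: power_add power2_eq_square del: of_nat_Suc)
    finally show "(\<integral>\<^sup>+x. ennreal (?a k) * indicator (ball (0::'a) (real (Suc k))) x \<partial>lborel)
      = ennreal (?V * (1 / real (Suc k) ^ 2))" .
  qed
  also have "\<dots> = ennreal (\<Sum>k. ?V * (1 / real (Suc k) ^ 2))"
    by (intro suminf_ennreal2 summable_mult summ) auto
  also have "\<dots> < \<infinity>" by simp
  finally show "(\<integral>\<^sup>+x. ennreal (norm (1 / (1 + norm (x::'a)) ^ (?d + 2))) \<partial>lborel) < \<infinity>" .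
qed

lemma rapidly_decreasing_integrable:
  fixes f :: "'a::euclidean_space \<Rightarrow> complex"
  assumes "rapidly_decreasing f" "f \<in> borel_measurable borel"
  shows "integrable lborel f"
proof -
  obtain C where C: "\<And>x. norm (f x) \<le> C / (1 + norm x) ^ (DIM('a) + 2)"
    using rapidly_decreasing_bound[OF assms(1)] by metis
  have "integrable lborel (\<lambda>x::'a. C * (1 / (1 + norm x) ^ (DIM('a) + 2)))"
    by (intro integrable_mult_right integrable_inverse_power_norm)
  then show ?thesis
  proof (rule Bochner_Integration.integrable_bound)
    show "AE x in lborel. norm (f x) \<le> norm (C * (1 / (1 + norm x) ^ (DIM('a) + 2)))"
      by (intro AE_I2 order_trans[OF C]) (metis abs_ge_self mult.right_neutral real_norm_def times_divide_eq_right)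
  qed (use assms(2) in simp)
qed

lemma schwartz_integrable: "\<phi> \<in> schwartz \<Longrightarrow> integrable lborel \<phi>"
  by (intro rapidly_decreasing_integrable schwartz_rapidly_decreasing schwartz_measurable)

lemma integral_affine:
  fixes f :: "'a::euclidean_space \<Rightarrow> complex"
  assumes "f \<in> borel_measurable borel" "c \<noteq> 0"
  shows "(\<integral>x. f x \<partial>lborel) = of_real (\<bar>c\<bar> ^ DIM('a)) * (\<integral>x. f (t + c *\<^sub>R x) \<partial>lborel)"
proof -
  have "(\<integral>x. f x \<partial>lborel)
      = (\<integral>x. f x \<partial>density (distr lborel borel (\<lambda>x. t + c *\<^sub>R x)) (\<lambda>_. ennreal (\<bar>c\<bar> ^ DIM('a))))"
    using lborel_affine[OF assms(2), of t] by (simp add: ennreal_power)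
  also have "\<dots> = \<bar>c\<bar> ^ DIM('a) *\<^sub>R (\<integral>x. f x \<partial>distr lborel borel (\<lambda>x. t + c *\<^sub>R x))"
    using assms(1) by (subst integral_density) auto
  also have "\<dots> = \<bar>c\<bar> ^ DIM('a) *\<^sub>R (\<integral>x. f (t + c *\<^sub>R x) \<partial>lborel)"
    using assms(1) by (subst integral_distr) auto
  finally show ?thesis
    by (simp add: scaleR_conv_of_real)
qed

section \<open>The Fourier transform of a Schwartz function\<close>

text \<open>
  The plane wave that is the kernel of the Fourier transform.
\<close>
abbreviation wave :: "'a::euclidean_space \<Rightarrow> 'a \<Rightarrow> complex" where
  "wave x y \<equiv> exp (- (\<i> * complex_of_real (x \<bullet> y)))"

lemma norm_wave [simp]: "norm (wave x y) = 1"
  using norm_exp_i_times[of "- (x \<bullet> y)"] by simp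

lemma integrable_wave:
  fixes f :: "'a::euclidean_space \<Rightarrow> complex"
  assumes "integrable lborel f"
  shows "integrable lborel (\<lambda>y. f y * wave x y)"
  using assms
proof (rule Bochner_Integration.integrable_bound)
  show "(\<lambda>y. f y * wave x y) \<in> borel_measurable lborel"
    using borel_measurable_integrable[OF assms] by measurable
qed (simp add: norm_mult)

lemma norm_fourier_le: "norm (fourier \<phi> x) \<le> (\<integral>y. norm (\<phi> y) \<partial>lborel)"
proof -
  have "norm (fourier \<phi> x) \<le> (\<integral>y. norm (\<phi> y * wave x y) \<partial>lborel)"
    unfolding fourier_def by (rule integral_norm_bound)
  then show ?thesis by (simp add: norm_mult)
qed

lemma fourier_cmult: "fourier (\<lambda>y. c * \<phi> y) x = c * fourier \<phi> x"
  by (simp add: fourier_def mult.assoc)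

text \<open>
  Second-order Taylor estimate for the exponential on the imaginary axis, at the point \<open>-\<langle>h, y\<rangle>\<close>.
\<close>
lemma norm_wave_taylor:
  "norm (wave (x + h) y - wave x y - (- \<i> * complex_of_real (h \<bullet> y)) * wave x y) \<le> (h \<bullet> y)\<^sup>2 / 2"
proof -
  have "wave (x + h) y - wave x y - (- \<i> * complex_of_real (h \<bullet> y)) * wave x y
     = wave x y * (exp (\<i> * complex_of_real (- (h \<bullet> y))) - (1 + \<i> * complex_of_real (- (h \<bullet> y))))"
    by (simp add: inner_add_left algebra_simps exp_add[symmetric])
  moreover have "norm (exp (\<i> * complex_of_real (- (h \<bullet> y))) - (1 + \<i> * complex_of_real (- (h \<bullet> y)))) \<le> (h \<bullet> y)\<^sup>2 / 2"
    using iexp_approx1[of "- (h \<bullet> y)" 1] by (simp add: numeral_2_eq_2)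
  ultimately show ?thesis by (simp add: norm_mult)
qed

text \<open>
  The integrated Taylor remainder of the kernel is at most \<open>\<bar>h\<bar>\<^sup>2 / 2 \<integral> \<bar>y\<bar>\<^sup>2 \<bar>\<phi>(y)\<bar> dy\<close>, and the integral is
  finite because \<open>\<phi>\<close> decreases rapidly. So one may differentiate under the integral sign.
\<close>
lemma fourier_has_derivative:
  fixes \<phi> :: "real^'n::finite \<Rightarrow> complex"
  assumes \<phi>: "\<phi> \<in> schwartz"
  shows "(fourier \<phi> has_derivative
    (\<lambda>h. \<Sum>i\<in>UNIV. h $ i *\<^sub>R fourier (\<lambda>y. - \<i> * (complex_of_real (y $ i) * \<phi> y)) x)) (at x)"
proof -
  let ?D = "\<lambda>h. \<Sum>i\<in>UNIV. h $ i *\<^sub>R fourier (\<lambda>y. - \<i> * (complex_of_real (y $ i) * \<phi> y)) x"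
  let ?q = "\<lambda>y. complex_of_real ((norm y)\<^sup>2) * \<phi> y"
  define K where "K = (\<integral>y. norm (?q y) \<partial>lborel) / 2"
  have "rapidly_decreasing ?q"
  proof (rule rapidly_decreasing_polynomial_mult)
    show "norm (complex_of_real ((norm y)\<^sup>2)) \<le> 1 * (1 + norm y) ^ 2" for y :: "real^'n"
      by (simp add: power_mono norm_power)
  qed (rule schwartz_rapidly_decreasing[OF \<phi>])
  then have int_q: "integrable lborel ?q"
    using schwartz_measurable[OF \<phi>] by (intro rapidly_decreasing_integrable) measurable
  have int_i: "integrable lborel (\<lambda>y. - \<i> * (complex_of_real (y $ i) * \<phi> y) * wave x y)" for i
    by (intro integrable_wave schwartz_integrable schwartz_cmult schwartz_coordinate_mult \<phi>)
  have int_w: "integrable lborel (\<lambda>y. \<phi> y * wave z y)" for z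
    by (intro integrable_wave schwartz_integrable \<phi>)
  have D: "?D h = (\<integral>y. \<phi> y * ((- \<i> * complex_of_real (h \<bullet> y)) * wave x y) \<partial>lborel)"
    and int_D: "integrable lborel (\<lambda>y. \<phi> y * ((- \<i> * complex_of_real (h \<bullet> y)) * wave x y))" for h
  proof -
    have eq: "\<phi> y * ((- \<i> * complex_of_real (h \<bullet> y)) * wave x y)
      = (\<Sum>i\<in>UNIV. h $ i *\<^sub>R (- \<i> * (complex_of_real (y $ i) * \<phi> y) * wave x y))" for y
      by (simp add: inner_vec_def sum_distrib_left sum_distrib_right scaleR_conv_of_real algebra_simps sum_negf)
    show "?D h = (\<integral>y. \<phi> y * ((- \<i> * complex_of_real (h \<bullet> y)) * wave x y) \<partial>lborel)"
      unfolding eq fourier_def using int_i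
      by (subst Bochner_Integration.integral_sum) (auto intro: integrable_scaleR_right)
    show "integrable lborel (\<lambda>y. \<phi> y * ((- \<i> * complex_of_real (h \<bullet> y)) * wave x y))"
      unfolding eq using int_i by (intro Bochner_Integration.integrable_sum integrable_scaleR_right) 
  qed
  have remainder: "norm (fourier \<phi> (x + h) - fourier \<phi> x - ?D h) \<le> K * (norm h)\<^sup>2" for h
  proof -
    let ?r = "\<lambda>y. wave (x + h) y - wave x y - (- \<i> * complex_of_real (h \<bullet> y)) * wave x y"
    have "fourier \<phi> (x + h) - fourier \<phi> x - ?D h = (\<integral>y. \<phi> y * ?r y \<partial>lborel)"
      unfolding D unfolding fourier_def
      by (simp only: right_diff_distrib Bochner_Integration.integral_diff
          Bochner_Integration.integrable_diff int_w int_D)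
    also have "norm \<dots> \<le> (\<integral>y. norm (?q y) * ((norm h)\<^sup>2 / 2) \<partial>lborel)"
    proof (rule order_trans[OF integral_norm_bound integral_mono])
      show "integrable lborel (\<lambda>y. norm (\<phi> y * ?r y))"
        by (rule integrable_norm)
           (simp only: right_diff_distrib Bochner_Integration.integrable_diff int_w int_D)
      show "integrable lborel (\<lambda>y. norm (?q y) * ((norm h)\<^sup>2 / 2))"
        by (intro integrable_mult_left integrable_norm int_q)
      show "norm (\<phi> y * ?r y) \<le> norm (?q y) * ((norm h)\<^sup>2 / 2)" for y
      proof -
        have "norm (?r y) \<le> (h \<bullet> y)\<^sup>2 / 2"
          by (rule norm_wave_taylor)
        also have "\<dots> \<le> (norm h * norm y)\<^sup>2 / 2"
          by (intro divide_right_mono) (simp_all add: abs_le_square_iff[symmetric] Cauchy_Schwarz_ineq2)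
        finally have "norm (\<phi> y) * norm (?r y) \<le> norm (\<phi> y) * ((norm h * norm y)\<^sup>2 / 2)"
          by (intro mult_left_mono) auto
        then show ?thesis
          unfolding norm_mult[of "\<phi> y"] by (simp add: norm_mult norm_power power_mult_distrib mult_ac)
      qed
    qed
    also have "\<dots> = K * (norm h)\<^sup>2"
      by (simp add: K_def)
    finally show ?thesis .
  qed
  show ?thesis
  proof (rule has_derivativeI_sandwich[of 1])
    show "bounded_linear ?D"
      unfolding linear_conv_bounded_linear[symmetric]
      by (auto simp: linear_iff scaleR_add_left sum.distrib scaleR_sum_right)
    show "norm ((fourier \<phi> y - fourier \<phi> x) - ?D (y - x)) / norm (y - x) \<le> K * norm (y - x)"
      if "y \<noteq> x" for y
    proof -
      have "norm (fourier \<phi> y - fourier \<phi> x - ?D (y - x)) / norm (y - x)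
          \<le> K * (norm (y - x))\<^sup>2 / norm (y - x)"
        using remainder[of "y - x"] by (intro divide_right_mono) auto
      also have "\<dots> = K * norm (y - x)"
        using that by (simp add: power2_eq_square)
      finally show ?thesis .
    qed
    have "((\<lambda>y. K * norm (y - x)) \<longlongrightarrow> K * norm (x - x)) (at x)"
      by (intro tendsto_intros)
    then show "((\<lambda>y. K * norm (y - x)) \<longlongrightarrow> 0) (at x)" by simp
  qed auto
qed

lemma fourier_translate:
  fixes \<phi> :: "real^'n::finite \<Rightarrow> complex"
  assumes \<phi>: "\<phi> \<in> borel_measurable borel"
  shows "fourier (\<lambda>y. \<phi> (y + b)) x = exp (\<i> * complex_of_real (x \<bullet> b)) * fourier \<phi> x"
proof -
  have "fourier \<phi> x = (\<integral>y. \<phi> (b + 1 *\<^sub>R y) * wave x (b + 1 *\<^sub>R y) \<partial>lborel)"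
    unfolding fourier_def
    using \<phi> integral_affine[of "\<lambda>y. \<phi> y * wave x y" 1 b] by simp
  also have "\<dots> = (\<integral>y. wave x b * (\<phi> (y + b) * wave x y) \<partial>lborel)"
    by (rule Bochner_Integration.integral_cong)
       (simp_all add: inner_add_right exp_add exp_diff exp_minus divide_inverse algebra_simps)
  also have "\<dots> = wave x b * fourier (\<lambda>y. \<phi> (y + b)) x"
    by (simp add: fourier_def)
  finally show ?thesis
    by (simp add: mult.assoc[symmetric] exp_add[symmetric])
qed

lemma schwartz_line_derivative:
  fixes \<phi> :: "real^'n::finite \<Rightarrow> complex"
  assumes "\<phi> \<in> schwartz"
  shows "((\<lambda>s. \<phi> (y + s *\<^sub>R axis j 1)) has_derivative (\<lambda>h. h *\<^sub>R partial_deriv j \<phi> (y + s *\<^sub>R axis j 1))) (at s)"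
proof -
  have "((\<lambda>s. y + s *\<^sub>R axis j 1) has_derivative (\<lambda>h. 0 + h *\<^sub>R axis j 1)) (at s)"
    by (intro has_derivative_add has_derivative_const has_derivative_scaleR_left has_derivative_ident)
  then have "((\<lambda>s. y + s *\<^sub>R axis j 1) has_derivative (\<lambda>h. h *\<^sub>R axis j 1)) (at s)"
    by simp
  from has_derivative_compose[OF this schwartz_has_derivative[OF assms]]
  have "((\<lambda>s. \<phi> (y + s *\<^sub>R axis j 1)) has_derivative
     (\<lambda>h. \<Sum>i\<in>UNIV. (h *\<^sub>R axis j 1) $ i *\<^sub>R partial_deriv i \<phi> (y + s *\<^sub>R axis j 1))) (at s)" .
  moreover have "(\<Sum>i\<in>UNIV. (h *\<^sub>R axis j 1) $ i *\<^sub>R partial_deriv i \<phi> z) = h *\<^sub>R partial_deriv j \<phi> z" for h z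
  proof -
    have "(\<Sum>i\<in>UNIV. (h *\<^sub>R axis j 1) $ i *\<^sub>R partial_deriv i \<phi> z)
        = h *\<^sub>R (\<Sum>i\<in>UNIV. axis j (1::real) $ i *\<^sub>R partial_deriv i \<phi> z)"
      unfolding scaleR_sum_right by simp
    then show ?thesis by simp
  qed
  ultimately show ?thesis by simp
qed

text \<open>
  A bound for difference quotients that does not depend on the step size; it provides the integrable majorant for
  \<open>fourier_partial_deriv\<close>. By the mean value inequality a difference is controlled by the partial derivative on a
  segment of length at most 1, and on such a segment the weight \<open>1 + \<bar>y\<bar>\<close> changes at most by the factor 2.
\<close>
lemma schwartz_difference_bound:
  fixes \<phi> :: "real^'n::finite \<Rightarrow> complex"
  assumes \<phi>: "\<phi> \<in> schwartz"
  obtains C where "C \<ge> 0"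
    "\<And>y t. 0 \<le> t \<Longrightarrow> t \<le> 1 \<Longrightarrow> norm (\<phi> (y + t *\<^sub>R axis j 1) - \<phi> y) \<le> t * (C / (1 + norm y) ^ N)"
proof -
  obtain C where C0: "C \<ge> 0" and C: "\<And>x. norm (partial_deriv j \<phi> x) \<le> C / (1 + norm x) ^ N"
    using rapidly_decreasing_bound[OF schwartz_rapidly_decreasing[OF schwartz_partial_deriv[OF \<phi>]]] by blast
  have shift: "norm (partial_deriv j \<phi> (y + s *\<^sub>R axis j 1)) \<le> C * 2 ^ N / (1 + norm y) ^ N"
    if "0 \<le> s" "s \<le> 1" for s y
  proof -
    let ?z = "y + s *\<^sub>R axis j 1"
    have "norm y \<le> norm ?z + s"
      using norm_triangle_ineq4[of ?z "s *\<^sub>R axis j 1"] that by simp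
    moreover have "1 + a \<le> 2 * (1 + b)" if "a \<le> b + s" "s \<le> 1" "0 \<le> b" for a b :: real
      using that by argo
    ultimately have "1 + norm y \<le> 2 * (1 + norm ?z)"
      using that(2) norm_ge_zero[of ?z] by blast
    then have "(1 + norm y) ^ N \<le> (2 * (1 + norm ?z)) ^ N"
      by (intro power_mono) auto
    then have le: "(1 + norm y) ^ N \<le> 2 ^ N * (1 + norm ?z) ^ N"
      by (simp only: power_mult_distrib)
    have pos: "(1 + norm y) ^ N > 0" "(1 + norm ?z) ^ N > 0"
      by (simp_all add: add_pos_nonneg)
    have "C / (1 + norm ?z) ^ N \<le> C * 2 ^ N / (1 + norm y) ^ N"
      using mult_left_mono[OF le C0] pos by (simp add: field_simps)
    then show ?thesis using C[of ?z] by linarith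
  qed
  show ?thesis
  proof
    show "C * 2 ^ N \<ge> 0" using C0 by simp
    fix y :: "real^'n" and t :: real
    assume t: "0 \<le> t" "t \<le> 1"
    have "norm (\<phi> (y + t *\<^sub>R axis j 1) - \<phi> (y + 0 *\<^sub>R axis j 1)) \<le> C * 2 ^ N / (1 + norm y) ^ N * norm (t - 0)"
    proof (rule differentiable_bound[of "{0..1}"])
      show "((\<lambda>s. \<phi> (y + s *\<^sub>R axis j 1)) has_derivative
          (\<lambda>h. h *\<^sub>R partial_deriv j \<phi> (y + s *\<^sub>R axis j 1))) (at s within {0..1})" for s
        by (rule has_derivative_at_withinI[OF schwartz_line_derivative[OF \<phi>]])
      show "onorm (\<lambda>h. h *\<^sub>R partial_deriv j \<phi> (y + s *\<^sub>R axis j 1)) \<le> C * 2 ^ N / (1 + norm y) ^ N"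
        if "s \<in> {0..1}" for s
      proof (rule onorm_le)
        fix h :: real
        show "norm (h *\<^sub>R partial_deriv j \<phi> (y + s *\<^sub>R axis j 1)) \<le> C * 2 ^ N / (1 + norm y) ^ N * norm h"
          using mult_right_mono[OF shift[of s y], of "\<bar>h\<bar>"] that by (simp add: mult.commute)
      qed
    qed (use t in auto)
    then show "norm (\<phi> (y + t *\<^sub>R axis j 1) - \<phi> y) \<le> t * (C * 2 ^ N / (1 + norm y) ^ N)"
      using t by (simp add: mult.commute)
  qed
qed

text \<open>
  Integration by parts without boundary terms: a translation by \<open>t e\<^sub>j\<close> multiplies the Fourier transform
  by \<open>exp (i t x\<^sub>j)\<close>. Dividing the difference by \<open>t\<close> and letting \<open>t\<close> tend to 0 gives the formula, by
  dominated convergence under the integral.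
\<close>
lemma fourier_partial_deriv:
  fixes \<phi> :: "real^'n::finite \<Rightarrow> complex"
  assumes \<phi>: "\<phi> \<in> schwartz"
  shows "fourier (partial_deriv j \<phi>) x = \<i> * complex_of_real (x $ j) * fourier \<phi> x"
proof -
  define t where "t n = 1 / real (Suc n)" for n
  have t: "0 < t n" "t n \<le> 1" for n by (simp_all add: t_def)
  have t_lim: "t \<longlonglongrightarrow> 0"
    unfolding t_def by (rule LIMSEQ_Suc[OF lim_1_over_n])
  have t_at: "filterlim t (at 0) sequentially"
    using t_lim t(1) by (auto simp: filterlim_at less_imp_neq[symmetric] intro!: always_eventually)
  let ?q = "\<lambda>n y. (\<phi> (y + t n *\<^sub>R axis j 1) - \<phi> y) / complex_of_real (t n)"
  obtain C where C: "C \<ge> 0"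
    "\<And>y s. 0 \<le> s \<Longrightarrow> s \<le> 1 \<Longrightarrow> norm (\<phi> (y + s *\<^sub>R axis j 1) - \<phi> y) \<le> s * (C / (1 + norm y) ^ (CARD('n) + 2))"
    using schwartz_difference_bound[OF \<phi>] by blast
  have meas [measurable]: "\<phi> \<in> borel_measurable borel" "partial_deriv j \<phi> \<in> borel_measurable borel"
    using schwartz_measurable schwartz_partial_deriv \<phi> by blast+
  have eq: "(\<integral>y. ?q n y * wave x y \<partial>lborel) =
      (exp (\<i> * complex_of_real (x $ j * t n)) - 1) / complex_of_real (t n) * fourier \<phi> x" for n
  proof -
    have "(\<integral>y. ?q n y * wave x y \<partial>lborel)
      = (\<integral>y. (\<phi> (y + t n *\<^sub>R axis j 1) * wave x y - \<phi> y * wave x y) / complex_of_real (t n) \<partial>lborel)"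
      by (simp add: diff_divide_distrib left_diff_distrib)
    also have "\<dots> = (fourier (\<lambda>y. \<phi> (y + t n *\<^sub>R axis j 1)) x - fourier \<phi> x) / complex_of_real (t n)"
      unfolding fourier_def
      by (subst Bochner_Integration.integral_divide_zero, subst Bochner_Integration.integral_diff)
         (simp_all add: integrable_wave schwartz_integrable schwartz_translate \<phi>)
    also have "\<dots> = (exp (\<i> * complex_of_real (x $ j * t n)) - 1) / complex_of_real (t n) * fourier \<phi> x"
      by (simp add: fourier_translate inner_axis algebra_simps)
    finally show ?thesis .
  qed
  have "(\<lambda>n. \<integral>y. ?q n y * wave x y \<partial>lborel) \<longlonglongrightarrow> fourier (partial_deriv j \<phi>) x"
    unfolding fourier_def
  proof (rule integral_dominated_convergence)
    show "integrable lborel (\<lambda>y::real^'n. C * (1 / (1 + norm y) ^ (DIM(real^'n) + 2)))"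
      by (intro integrable_mult_right integrable_inverse_power_norm)
    show "AE y in lborel. (\<lambda>n. ?q n y * wave x y) \<longlonglongrightarrow> partial_deriv j \<phi> y * wave x y"
    proof (rule AE_I2, rule tendsto_mult_right)
      fix y
      have "((\<lambda>s. norm (\<phi> (y + s *\<^sub>R axis j 1) - \<phi> y - s *\<^sub>R partial_deriv j \<phi> y) / norm s) \<longlongrightarrow> 0) (at 0)"
        using schwartz_line_derivative[OF \<phi>, of y j 0] by (simp add: has_derivative_at)
      moreover have "\<forall>\<^sub>F s in at 0.
          norm (\<phi> (y + s *\<^sub>R axis j 1) - \<phi> y - s *\<^sub>R partial_deriv j \<phi> y) / norm s
          = norm ((\<phi> (y + s *\<^sub>R axis j 1) - \<phi> y) /\<^sub>R s - partial_deriv j \<phi> y)"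
      proof (rule eventually_at_filter[THEN iffD2], intro always_eventually allI impI)
        fix s :: real
        assume "s \<noteq> 0"
        have "norm (z - s *\<^sub>R d) / norm s = norm (z /\<^sub>R s - d)" for z d :: complex
        proof -
          have "z /\<^sub>R s - d = (z - s *\<^sub>R d) /\<^sub>R s"
            using \<open>s \<noteq> 0\<close> by (simp add: scaleR_right_diff_distrib)
          then show ?thesis
            by (simp add: divide_inverse mult.commute)
        qed
        then show "norm (\<phi> (y + s *\<^sub>R axis j 1) - \<phi> y - s *\<^sub>R partial_deriv j \<phi> y) / norm s
          = norm ((\<phi> (y + s *\<^sub>R axis j 1) - \<phi> y) /\<^sub>R s - partial_deriv j \<phi> y)" .
      qed
      ultimately have "((\<lambda>s. norm ((\<phi> (y + s *\<^sub>R axis j 1) - \<phi> y) /\<^sub>R s - partial_deriv j \<phi> y)) \<longlongrightarrow> 0) (at 0)"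
        by (rule Lim_transform_eventually)
      then have "((\<lambda>s. (\<phi> (y + s *\<^sub>R axis j 1) - \<phi> y) /\<^sub>R s) \<longlongrightarrow> partial_deriv j \<phi> y) (at 0)"
        by (simp only: tendsto_norm_zero_iff LIM_zero_iff)
      from filterlim_compose[OF this t_at]
      show "(\<lambda>n. ?q n y) \<longlonglongrightarrow> partial_deriv j \<phi> y"
        by (simp add: scaleR_conv_of_real divide_inverse mult.commute)
    qed
    show "AE y in lborel. norm (?q n y * wave x y) \<le> C * (1 / (1 + norm y) ^ (DIM(real^'n) + 2))" for n
    proof (rule AE_I2)
      fix y
      show "norm (?q n y * wave x y) \<le> C * (1 / (1 + norm y) ^ (DIM(real^'n) + 2))"
      proof -
        have "norm (?q n y * wave x y) = norm (\<phi> (y + t n *\<^sub>R axis j 1) - \<phi> y) / t n"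
          using t[of n] unfolding norm_mult norm_wave by (simp add: norm_divide)
        also have "\<dots> \<le> C / (1 + norm y) ^ (DIM(real^'n) + 2)"
          using C(2)[of "t n" y] t[of n] by (simp add: pos_divide_le_eq mult.commute)
        finally show ?thesis by simp
      qed
    qed
  qed measurable
  moreover have "(\<lambda>n. (exp (\<i> * complex_of_real (x $ j * t n)) - 1) / complex_of_real (t n) * fourier \<phi> x)
     \<longlonglongrightarrow> \<i> * complex_of_real (x $ j) * fourier \<phi> x"
  proof (rule tendsto_mult_right)
    have "((\<lambda>s. exp (\<i> * complex_of_real (x $ j) * s)) has_field_derivative \<i> * complex_of_real (x $ j)) (at 0)"
      by (auto intro!: derivative_eq_intros)
    then have "((\<lambda>s. (exp (\<i> * complex_of_real (x $ j) * s) - 1) / s) \<longlongrightarrow> \<i> * complex_of_real (x $ j)) (at 0)"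
      by (simp add: has_field_derivative_iff)
    moreover have "filterlim (\<lambda>n. complex_of_real (t n)) (at 0) sequentially"
      using tendsto_of_real[OF t_lim, where ?'a = complex] t(1)
      by (auto simp: filterlim_at less_imp_neq[symmetric] intro!: always_eventually)
    ultimately show "(\<lambda>n. (exp (\<i> * complex_of_real (x $ j * t n)) - 1) / complex_of_real (t n)) \<longlonglongrightarrow> \<i> * complex_of_real (x $ j)"
      using filterlim_compose by (fastforce simp: mult.assoc)
  qed
  ultimately show ?thesis
    unfolding eq by (rule LIMSEQ_unique)
qed

text \<open>
  Multiplication of \<open>F\<phi>\<close> by a coordinate turns \<open>\<phi>\<close> into a partial derivative, which is again a Schwartz
  function, and the Fourier transform of an integrable function is bounded. The induction runs with the weight
  \<open>1 + \<Sum> \<bar>x\<^sub>j\<bar>\<close>, which is linear in the \<open>\<bar>x\<^sub>j\<bar>\<close> and dominates \<open>1 + \<bar>x\<bar>\<close>.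
\<close>
lemma fourier_rapidly_decreasing:
  fixes \<phi> :: "real^'n::finite \<Rightarrow> complex"
  assumes "\<phi> \<in> schwartz"
  shows "rapidly_decreasing (fourier \<phi>)"
proof -
  let ?s = "\<lambda>x::real^'n. \<Sum>j\<in>UNIV. \<bar>x $ j\<bar>"
  have bound: "\<exists>C. \<forall>x. (1 + ?s x) ^ N * norm (fourier \<phi> x) \<le> C" for N
    using assms
  proof (induction N arbitrary: \<phi>)
    case 0
    then show ?case
      using norm_fourier_le by auto
  next
    case (Suc N)
    obtain C where C: "\<And>x. (1 + ?s x) ^ N * norm (fourier \<phi> x) \<le> C"
      using Suc by blast
    have "\<exists>D. \<forall>x. (1 + ?s x) ^ N * norm (fourier (partial_deriv j \<phi>) x) \<le> D" for j
      by (intro Suc.IH schwartz_partial_deriv Suc.prems)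
    then obtain D where D: "\<And>j x. (1 + ?s x) ^ N * norm (fourier (partial_deriv j \<phi>) x) \<le> D j"
      by metis
    have "(1 + ?s x) ^ Suc N * norm (fourier \<phi> x) \<le> C + (\<Sum>j\<in>UNIV. D j)" for x
    proof -
      have "(1 + ?s x) ^ Suc N * norm (fourier \<phi> x)
        = (1 + ?s x) ^ N * norm (fourier \<phi> x) + (\<Sum>j\<in>UNIV. (1 + ?s x) ^ N * (\<bar>x $ j\<bar> * norm (fourier \<phi> x)))"
        by (simp add: algebra_simps sum_distrib_left sum_distrib_right)
      also have "\<dots> = (1 + ?s x) ^ N * norm (fourier \<phi> x)
          + (\<Sum>j\<in>UNIV. (1 + ?s x) ^ N * norm (fourier (partial_deriv j \<phi>) x))"
        by (simp add: fourier_partial_deriv[OF Suc.prems] norm_mult)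
      also have "\<dots> \<le> C + (\<Sum>j\<in>UNIV. D j)"
        by (intro add_mono sum_mono C D)
      finally show ?thesis .
    qed
    then show ?case by blast
  qed
  show ?thesis
    unfolding rapidly_decreasing_def
  proof
    fix N
    obtain C where C: "\<And>x. (1 + ?s x) ^ N * norm (fourier \<phi> x) \<le> C"
      using bound by blast
    have "(1 + norm x) ^ N * norm (fourier \<phi> x) \<le> C" for x
    proof -
      have "(1 + norm x) ^ N * norm (fourier \<phi> x) \<le> (1 + ?s x) ^ N * norm (fourier \<phi> x)"
        by (intro mult_right_mono power_mono add_left_mono norm_le_l1_cart) auto
      then show ?thesis using C[of x] by linarith
    qed
    then show "\<exists>C. \<forall>x. (1 + norm x) ^ N * norm (fourier \<phi> x) \<le> C" by blast
  qed
qed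

text \<open>
  The image of the Schwartz space is closed under partial derivatives, since differentiating \<open>F\<phi>\<close> amounts to multiplying
  \<open>\<phi>\<close> by \<open>-i y\<^sub>j\<close>.
\<close>
lemma schwartz_fourier:
  fixes \<phi> :: "real^'n::finite \<Rightarrow> complex"
  assumes "\<phi> \<in> schwartz"
  shows "fourier \<phi> \<in> schwartz"
proof (rule schwartz_coinduct[of _ "fourier ` schwartz"])
  show "fourier \<phi> \<in> fourier ` schwartz"
    using assms by blast
next
  fix \<psi> :: "real^'n \<Rightarrow> complex"
  assume "\<psi> \<in> fourier ` schwartz"
  then show "rapidly_decreasing \<psi>"
    by (auto intro: fourier_rapidly_decreasing)
next
  fix \<psi> :: "real^'n \<Rightarrow> complex"
  assume "\<psi> \<in> fourier ` schwartz"
  then obtain f where f: "f \<in> schwartz" "\<psi> = fourier f" by blast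
  let ?D = "\<lambda>x h. \<Sum>i\<in>UNIV. h $ i *\<^sub>R fourier (\<lambda>y. - \<i> * (complex_of_real (y $ i) * f y)) x"
  have "(\<psi> has_derivative ?D x) (at x)" for x
    unfolding f(2) by (rule fourier_has_derivative[OF f(1)])
  moreover have "(\<lambda>x. ?D x (axis i 1)) \<in> fourier ` schwartz" for i
    unfolding sum_axis_scaleR
    by (intro imageI schwartz_cmult schwartz_coordinate_mult f)
  ultimately show "\<exists>D. (\<forall>x. (\<psi> has_derivative D x) (at x)) \<and> (\<forall>i. (\<lambda>x. D x (axis i 1)) \<in> fourier ` schwartz)"
    by (intro exI[of _ ?D]) blast
qed

definition gaussian :: "real^'n::finite \<Rightarrow> complex" where
  "gaussian x = complex_of_real (exp (- ((x \<bullet> x) / 2)))"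

section \<open>The Gaussian\<close>

text \<open>
  The Gaussian is the case \<open>c = -1\<close>, its reciprocal the case \<open>c = 1\<close>.
\<close>
lemma exp_quadratic_has_derivative:
  fixes x :: "'a::real_inner"
  shows "((\<lambda>x. complex_of_real (exp (c * ((x \<bullet> x) / 2)))) has_derivative
    (\<lambda>h. complex_of_real (c * (x \<bullet> h)) * complex_of_real (exp (c * ((x \<bullet> x) / 2))))) (at x)"
proof -
  have "((\<lambda>x. exp (c * ((x \<bullet> x) / 2))) has_derivative
    (\<lambda>h. c * ((x \<bullet> h + h \<bullet> x) / 2) * exp (c * ((x \<bullet> x) / 2)))) (at x)"
    unfolding divide_inverse
    by (intro has_derivative_exp has_derivative_mult_right has_derivative_mult_left has_derivative_inner
        has_derivative_ident)
  then have "((\<lambda>x. exp (c * ((x \<bullet> x) / 2))) has_derivative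
    (\<lambda>h. (c * (x \<bullet> h)) * exp (c * ((x \<bullet> x) / 2)))) (at x)"
    by (simp add: inner_commute)
  from has_derivative_of_real[OF this, where ?'a = complex] show ?thesis
    by simp
qed

lemma gaussian_has_derivative:
  "(gaussian has_derivative (\<lambda>h. - complex_of_real (x \<bullet> h) * gaussian x)) (at x)"
  using exp_quadratic_has_derivative[of "-1" x] by (simp add: gaussian_def[abs_def])

lemma partial_deriv_gaussian: "partial_deriv i gaussian = (\<lambda>x. - 1 * (complex_of_real (x $ i) * gaussian x))"
  by (rule ext) (simp add: partial_deriv_eq[OF gaussian_has_derivative] inner_axis)

text \<open>
  With \<open>1 + r \<le> exp r\<close> the product is at most \<open>exp (N r - r\<^sup>2 / 2)\<close>, whose exponent is largest at \<open>r = N\<close>.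
\<close>
lemma gaussian_rapidly_decreasing: "rapidly_decreasing gaussian"
  unfolding rapidly_decreasing_def
proof
  fix N
  have "(1 + norm x) ^ N * norm (gaussian x) \<le> exp ((real N)\<^sup>2 / 2)" for x :: "real^'n"
  proof -
    have "(1 + norm x) ^ N \<le> exp (norm x) ^ N"
      by (intro power_mono exp_ge_add_one_self) auto
    also have "\<dots> = exp (real N * norm x)"
      by (simp add: exp_of_nat_mult)
    finally have "(1 + norm x) ^ N * norm (gaussian x) \<le> exp (real N * norm x) * norm (gaussian x)"
      by (intro mult_right_mono) auto
    also have "\<dots> = exp (real N * norm x - (norm x)\<^sup>2 / 2)"
    proof -
      have "norm (gaussian x) = exp (- ((norm x)\<^sup>2 / 2))"
        by (simp add: gaussian_def power2_norm_eq_inner)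
      then show ?thesis
        by (simp flip: exp_add)
    qed
    also have "\<dots> \<le> exp ((real N)\<^sup>2 / 2)"
      using zero_le_power2[of "real N - norm x"] by (simp add: power2_diff field_simps)
    finally show ?thesis .
  qed
  then show "\<exists>C. \<forall>x::real^'n. (1 + norm x) ^ N * norm (gaussian x) \<le> C" by blast
qed

text \<open>
  Products of monomials with the Gaussian. Their derivatives are linear combinations of such products, which makes
  them a coinductive set for \<open>schwartz_gaussian\<close>.
\<close>
inductive_set gaussian_monomials :: "(real^'n::finite \<Rightarrow> complex) set" where
  gaussian: "gaussian \<in> gaussian_monomials"
| coordinate: "f \<in> gaussian_monomials \<Longrightarrow> (\<lambda>x. complex_of_real (x $ j) * f x) \<in> gaussian_monomials"

lemma gaussian_span_coordinate_mult:
  assumes "f \<in> complex_span gaussian_monomials"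
  shows "(\<lambda>x. complex_of_real (x $ j) * f x) \<in> complex_span gaussian_monomials"
  using assms
proof induction
  case zero
  then show ?case by (simp add: complex_span.zero)
next
  case (base f)
  then show ?case by (intro complex_span.base gaussian_monomials.coordinate)
next
  case (add f g)
  then show ?case by (auto simp: distrib_left dest: complex_span.add)
next
  case (scale f c)
  then show ?case by (auto simp: mult.left_commute[of _ c] intro: complex_span.scale)
qed

lemma schwartz_gaussian: "gaussian \<in> schwartz"
proof (rule schwartz_coinduct_span[of _ gaussian_monomials])
  show "gaussian \<in> complex_span gaussian_monomials"
    by (intro complex_span.base gaussian_monomials.gaussian)
next
  fix \<psi> :: "real^'n \<Rightarrow> complex"
  assume "\<psi> \<in> gaussian_monomials"
  then show "rapidly_decreasing \<psi>"
  proof induction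
    case gaussian
    then show ?case by (rule gaussian_rapidly_decreasing)
  next
    case (coordinate f j)
    show ?case
    proof (rule rapidly_decreasing_polynomial_mult)
      show "norm (complex_of_real (x $ j)) \<le> 1 * (1 + norm x) ^ 1" for x :: "real^'n"
        using component_le_norm_cart[of x j] by simp
    qed (rule coordinate.IH)
  qed
next
  fix \<psi> :: "real^'n \<Rightarrow> complex"
  assume "\<psi> \<in> gaussian_monomials"
  then show "\<exists>D. (\<forall>x. (\<psi> has_derivative D x) (at x)) \<and> (\<forall>i. (\<lambda>x. D x (axis i 1)) \<in> complex_span gaussian_monomials)"
  proof induction
    case gaussian
    have "(\<lambda>x. - complex_of_real (x \<bullet> axis i 1) * gaussian x) \<in> complex_span gaussian_monomials" for i :: 'n
      using complex_span.scale[OF complex_span.base[OF gaussian_monomials.coordinate[OF gaussian_monomials.gaussian]], of "-1" i]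
      by (simp add: inner_axis)
    then show ?case
      by (intro exI[of _ "\<lambda>x h. - complex_of_real (x \<bullet> h) * gaussian x"] conjI allI gaussian_has_derivative)
  next
    case (coordinate f j)
    then obtain D where D: "\<And>x. (f has_derivative D x) (at x)"
      "\<And>i. (\<lambda>x. D x (axis i 1)) \<in> complex_span gaussian_monomials" by blast
    have "((\<lambda>x. complex_of_real (x $ j)) has_derivative (\<lambda>h. complex_of_real (h $ j))) (at x)" for x :: "real^'n"
      by (rule bounded_linear_imp_has_derivative)
         (rule bounded_linear_compose[OF bounded_linear_of_real bounded_linear_vec_nth])
    then have "((\<lambda>x. complex_of_real (x $ j) * f x) has_derivative
        (\<lambda>h. complex_of_real (x $ j) * D x h + complex_of_real (h $ j) * f x)) (at x)" for x
      by (intro has_derivative_mult D)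
    moreover have "(\<lambda>x. complex_of_real (x $ j) * D x (axis i 1) + complex_of_real (axis i 1 $ j) * f x)
        \<in> complex_span gaussian_monomials" for i
      by (intro complex_span.add complex_span.scale gaussian_span_coordinate_mult D complex_span.base coordinate.hyps)
    ultimately show ?case
      by (intro exI[of _ "\<lambda>x h. complex_of_real (x $ j) * D x h + complex_of_real (h $ j) * f x"]) blast
  qed
qed

lemma integral_gaussian_nonzero: "(\<integral>x. gaussian x \<partial>lborel) \<noteq> 0"
proof
  assume zero: "(\<integral>x. gaussian (x::real^'n) \<partial>lborel) = 0"
  let ?g = "\<lambda>x::real^'n. exp (- ((x \<bullet> x) / 2))"
  have int: "integrable lborel ?g"
    using schwartz_integrable[OF schwartz_gaussian, where ?'a = 'n] unfolding gaussian_def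
    by (simp add: complex_of_real_integrable_eq)
  have "(\<integral>x. ?g x \<partial>lborel) = 0"
    using zero unfolding gaussian_def integral_complex_of_real of_real_eq_0_iff .
  then have "AE x in lborel. ?g x = 0"
    using integral_nonneg_eq_0_iff_AE[OF int] by simp
  then have "AE x in (lborel :: (real^'n) measure). False" by simp
  then show False
    by (auto simp: eventually_ae_filter null_sets_def dest: top.extremum_uniqueI)
qed

text \<open>
  The Gaussian satisfies \<open>\<partial>\<^sub>i g = -x\<^sub>i g\<close>. The Fourier transform exchanges differentiation and multiplication by
  coordinates, so \<open>Fg\<close> satisfies the same equation, and \<open>Fg / g\<close> has zero gradient.
\<close>
lemma fourier_gaussian: "fourier gaussian x = fourier gaussian (0 :: real^'n) * gaussian x"
  for x :: "real^'n::finite"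
proof -
  let ?E = "\<lambda>x::real^'n. complex_of_real (exp ((x \<bullet> x) / 2))"
  have E: "(?E has_derivative (\<lambda>h. complex_of_real (x \<bullet> h) * ?E x)) (at x)" for x :: "real^'n"
    using exp_quadratic_has_derivative[of 1 x] by simp
  have grad: "fourier (\<lambda>y. - \<i> * (complex_of_real (y $ i) * gaussian y)) x
      = - complex_of_real (x $ i) * fourier gaussian x" for i and x :: "real^'n"
  proof -
    have "(\<lambda>y. - \<i> * (complex_of_real (y $ i) * gaussian y)) = (\<lambda>y. \<i> * partial_deriv i gaussian y)"
      by (simp add: partial_deriv_gaussian)
    then show ?thesis
      by (simp add: fourier_cmult fourier_partial_deriv schwartz_gaussian mult.assoc del: mult_minus_left)
  qed
  have F: "(fourier gaussian has_derivative (\<lambda>h. - complex_of_real (x \<bullet> h) * fourier gaussian x)) (at x)" for x :: "real^'n"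
  proof -
    have "(\<Sum>i\<in>UNIV. h $ i *\<^sub>R fourier (\<lambda>y. - \<i> * (complex_of_real (y $ i) * gaussian y)) x)
      = - complex_of_real (x \<bullet> h) * fourier gaussian x" for h
      unfolding grad by (simp add: inner_vec_def sum_distrib_left scaleR_conv_of_real sum_negf mult_ac)
    then show ?thesis
      using fourier_has_derivative[OF schwartz_gaussian, of x] by simp
  qed
  have "((\<lambda>x. fourier gaussian x * ?E x) has_derivative (\<lambda>h. 0)) (at x)" for x
    using has_derivative_mult[OF F[of x] E[of x]] by (simp add: algebra_simps)
  then obtain c where c: "\<And>x::real^'n. fourier gaussian x * ?E x = c"
    using has_derivative_zero_constant[of UNIV "\<lambda>x. fourier gaussian x * ?E x"] by auto
  have "fourier gaussian x * ?E x * gaussian x = fourier gaussian (0 :: real^'n) * gaussian x"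
    using c[of x] c[of 0] by simp
  moreover have "?E x * gaussian x = 1"
    by (simp add: gaussian_def exp_minus flip: of_real_mult)
  ultimately show ?thesis by (simp add: mult.assoc)
qed

section \<open>The inversion formula\<close>

text \<open>
  Both sides are the double integral of \<open>f(x) \<phi>(y) exp (-i \<langle>A x, y\<rangle>)\<close>, where \<open>B\<close> is the adjoint of \<open>A\<close>. With \<open>A\<close> the
  identity this is the multiplication formula used for inversion; with \<open>A\<close> the parametrisation of a subspace it computes the
  Fourier transform of a distribution supported there.
\<close>
lemma integral_mult_fourier:
  fixes f :: "real^'k::finite \<Rightarrow> complex" and \<phi> :: "real^'n::finite \<Rightarrow> complex"
    and A :: "real^'k \<Rightarrow> real^'n"
  assumes f: "integrable lborel f" and \<phi>: "integrable lborel \<phi>"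
    and A: "linear A" and adj: "\<And>x y. A x \<bullet> y = x \<bullet> B y"
  shows "(\<integral>x. f x * fourier \<phi> (A x) \<partial>lborel) = (\<integral>y. fourier f (B y) * \<phi> y \<partial>lborel)"
proof -
  let ?F = "\<lambda>x y. f x * (\<phi> y * wave (A x) y)"
  have [measurable]: "f \<in> borel_measurable borel" "\<phi> \<in> borel_measurable borel"
    using borel_measurable_integrable[OF f] borel_measurable_integrable[OF \<phi>] by simp_all
  have [measurable]: "A \<in> borel_measurable borel"
    using A by (intro borel_measurable_continuous_onI linear_continuous_on) (simp add: linear_conv_bounded_linear)
  have int_y: "integrable lborel (?F x)" for x
    by (intro integrable_mult_right integrable_wave \<phi>)
  have "integrable (lborel \<Otimes>\<^sub>M lborel) (case_prod ?F)"
  proof (rule lborel_pair.Fubini_integrable)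
    show "case_prod ?F \<in> borel_measurable (lborel \<Otimes>\<^sub>M lborel)"
      by measurable
    show "integrable lborel (\<lambda>x. \<integral>y. norm (case_prod ?F (x, y)) \<partial>lborel)"
      using integrable_norm[OF f] by (simp add: norm_mult)
    show "AE x in lborel. integrable lborel (\<lambda>y. case_prod ?F (x, y))"
      using int_y by simp
  qed
  from lborel_pair.Fubini_integral[OF this]
  have "(\<integral>x. (\<integral>y. ?F x y \<partial>lborel) \<partial>lborel) = (\<integral>y. (\<integral>x. ?F x y \<partial>lborel) \<partial>lborel)"
    by simp
  moreover have "(\<integral>y. ?F x y \<partial>lborel) = f x * fourier \<phi> (A x)" for x
    by (simp add: fourier_def)
  moreover have "(\<integral>x. ?F x y \<partial>lborel) = fourier f (B y) * \<phi> y" for y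
  proof -
    have "?F x y = (f x * wave (B y) x) * \<phi> y" for x
      by (simp add: adj inner_commute[of "B y"])
    then show ?thesis
      by (simp only: fourier_def integral_mult_left_zero)
  qed
  ultimately show ?thesis by (simp only:)
qed

lemma schwartz_dilation_integral_limit:
  fixes \<phi> \<psi> :: "real^'n::finite \<Rightarrow> complex"
  assumes \<phi>: "\<phi> \<in> schwartz" and \<psi>: "\<psi> \<in> schwartz" and e: "e \<longlonglongrightarrow> 0"
  shows "(\<lambda>n. \<integral>x. \<phi> (e n *\<^sub>R x) * \<psi> x \<partial>lborel) \<longlonglongrightarrow> \<phi> 0 * (\<integral>x. \<psi> x \<partial>lborel)"
proof -
  obtain C where C: "C \<ge> 0" "\<And>x. norm (\<phi> x) \<le> C"
    using schwartz_bounded[OF \<phi>] by blast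
  have [measurable]: "\<phi> \<in> borel_measurable borel" "\<psi> \<in> borel_measurable borel"
    using \<phi> \<psi> by (auto intro: schwartz_measurable)
  have "(\<lambda>n. \<integral>x. \<phi> (e n *\<^sub>R x) * \<psi> x \<partial>lborel) \<longlonglongrightarrow> (\<integral>x. \<phi> 0 * \<psi> x \<partial>lborel)"
  proof (rule integral_dominated_convergence)
    show "integrable lborel (\<lambda>x. C * norm (\<psi> x))"
      by (intro integrable_mult_right integrable_norm schwartz_integrable \<psi>)
    show "AE x in lborel. (\<lambda>n. \<phi> (e n *\<^sub>R x) * \<psi> x) \<longlonglongrightarrow> \<phi> 0 * \<psi> x"
    proof (rule AE_I2, rule tendsto_mult_right)
      fix x :: "real^'n"
      have "(\<lambda>n. e n *\<^sub>R x) \<longlonglongrightarrow> 0 *\<^sub>R x"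
        by (rule tendsto_scaleR[OF e tendsto_const])
      moreover have "isCont \<phi> 0"
        using schwartz_differentiable[OF \<phi>] by (rule differentiable_imp_continuous_within)
      ultimately show "(\<lambda>n. \<phi> (e n *\<^sub>R x)) \<longlonglongrightarrow> \<phi> 0"
        by (auto intro: isCont_tendsto_compose)
    qed
    show "AE x in lborel. norm (\<phi> (e n *\<^sub>R x) * \<psi> x) \<le> C * norm (\<psi> x)" for n
      by (auto simp: norm_mult intro!: mult_right_mono C)
  qed measurable
  then show ?thesis by simp
qed

text \<open>
  The multiplication formula for \<open>\<phi>\<close> and the dilation \<open>x \<mapsto> g (\<epsilon> x)\<close> reads
  \<open>\<integral> g(\<epsilon> x) F\<phi>(x) dx = \<integral> \<phi>(\<epsilon> y) Fg(y) dy\<close> after a change of variables, and \<open>\<epsilon>\<close> tends to 0.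
\<close>
lemma integral_fourier_swap_at_zero:
  fixes \<phi> g :: "real^'n::finite \<Rightarrow> complex"
  assumes \<phi>: "\<phi> \<in> schwartz" and g: "g \<in> schwartz"
  shows "g 0 * (\<integral>x. fourier \<phi> x \<partial>lborel) = \<phi> 0 * (\<integral>x. fourier g x \<partial>lborel)"
proof -
  define e where "e n = 1 / real (Suc n)" for n
  have e: "e n > 0" for n by (simp add: e_def)
  have e_lim: "e \<longlonglongrightarrow> 0"
    unfolding e_def by (rule LIMSEQ_Suc[OF lim_1_over_n])
  have eq: "(\<integral>x. g (e n *\<^sub>R x) * fourier \<phi> x \<partial>lborel) = (\<integral>y. \<phi> (e n *\<^sub>R y) * fourier g y \<partial>lborel)" for n
  proof -
    let ?g = "\<lambda>x. g (e n *\<^sub>R x)" and ?c = "complex_of_real (\<bar>e n\<bar> ^ DIM(real^'n))"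
    have lin: "linear (\<lambda>x::real^'n. e n *\<^sub>R x)" "inj (\<lambda>x::real^'n. e n *\<^sub>R x)"
      using e[of n] by (auto simp: linear_iff algebra_simps inj_on_def)
    have ge: "?g \<in> schwartz"
      by (rule schwartz_linear[OF g lin])
    have scale: "fourier g y = ?c * fourier ?g (e n *\<^sub>R y)" for y
      unfolding fourier_def
      using integral_affine[of "\<lambda>u. g u * wave y u" "e n" 0] schwartz_measurable[OF g] e[of n]
      by (simp add: inner_commute)
    have "(\<integral>x. ?g x * fourier \<phi> x \<partial>lborel) = (\<integral>y. fourier ?g y * \<phi> y \<partial>lborel)"
      by (rule integral_mult_fourier[where A = "\<lambda>x. x" and B = "\<lambda>x. x"])
         (auto simp: linear_iff intro: schwartz_integrable ge \<phi>)
    also have "\<dots> = ?c * (\<integral>y. fourier ?g (e n *\<^sub>R y) * \<phi> (e n *\<^sub>R y) \<partial>lborel)"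
      using integral_affine[of "\<lambda>y. fourier ?g y * \<phi> y" "e n" 0] e[of n]
        schwartz_measurable[OF schwartz_fourier[OF ge]] schwartz_measurable[OF \<phi>]
      by simp
    also have "\<dots> = (\<integral>y. \<phi> (e n *\<^sub>R y) * fourier g y \<partial>lborel)"
      by (subst integral_mult_right_zero[symmetric]) (simp add: scale mult_ac)
    finally show ?thesis .
  qed
  have "(\<lambda>n. \<integral>x. g (e n *\<^sub>R x) * fourier \<phi> x \<partial>lborel) \<longlonglongrightarrow> g 0 * (\<integral>x. fourier \<phi> x \<partial>lborel)"
    by (rule schwartz_dilation_integral_limit[OF g schwartz_fourier[OF \<phi>] e_lim])
  moreover have "(\<lambda>n. \<integral>x. g (e n *\<^sub>R x) * fourier \<phi> x \<partial>lborel) \<longlonglongrightarrow> \<phi> 0 * (\<integral>x. fourier g x \<partial>lborel)"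
    unfolding eq by (rule schwartz_dilation_integral_limit[OF \<phi> schwartz_fourier[OF g] e_lim])
  ultimately show ?thesis
    by (rule LIMSEQ_unique)
qed

text \<open>
  Applied to the Gaussian, the preceding lemma evaluates \<open>\<integral> F\<phi>\<close> as \<open>c \<phi>(0)\<close>; a translate of \<open>\<phi>\<close> gives
  the value at any other point. The constant is \<open>\<integral> Fg = (\<integral> g)\<^sup>2\<close>.
\<close>
lemma fourier_fourier:
  obtains c where "c \<noteq> 0"
    "\<And>\<phi> x. \<phi> \<in> schwartz \<Longrightarrow> fourier (fourier \<phi>) x = c * \<phi> (- x :: real^'n::finite)"
proof
  let ?I = "\<integral>x. gaussian (x :: real^'n) \<partial>lborel"
  have "fourier gaussian (0::real^'n) = ?I"
    by (simp add: fourier_def)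
  then have F: "fourier gaussian = (\<lambda>x::real^'n. ?I * gaussian x)"
    using fourier_gaussian by metis
  show "(\<integral>x. fourier gaussian (x :: real^'n) \<partial>lborel) \<noteq> 0"
    unfolding F using integral_gaussian_nonzero[where ?'a = 'n] by simp
  fix \<phi> :: "real^'n \<Rightarrow> complex" and x
  assume \<phi>: "\<phi> \<in> schwartz"
  have "fourier (fourier \<phi>) x = (\<integral>y. fourier (\<lambda>z. \<phi> (z + (- x))) y \<partial>lborel)"
    unfolding fourier_def[of "fourier \<phi>"]
    using fourier_translate[OF schwartz_measurable[OF \<phi>], of "- x"]
    by (simp add: inner_commute mult.commute)
  also have "\<dots> = \<phi> (- x) * (\<integral>x. fourier gaussian (x :: real^'n) \<partial>lborel)"
    using integral_fourier_swap_at_zero[OF schwartz_translate[OF \<phi>, of "- x"] schwartz_gaussian]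
    by (simp add: gaussian_def)
  finally show "fourier (fourier \<phi>) x = (\<integral>x. fourier gaussian (x :: real^'n) \<partial>lborel) * \<phi> (- x)"
    by simp
qed

text \<open>
  Applying the transform four times multiplies by \<open>c\<^sup>2\<close>, because the two reflections cancel.
\<close>
lemma fourier_surj_schwartz:
  fixes \<psi> :: "real^'n::finite \<Rightarrow> complex"
  assumes \<psi>: "\<psi> \<in> schwartz"
  obtains \<phi> where "\<phi> \<in> schwartz" "fourier \<phi> = \<psi>"
proof -
  obtain c where "c \<noteq> 0" and c:
    "\<And>\<phi> x. \<phi> \<in> schwartz \<Longrightarrow> fourier (fourier \<phi>) x = c * \<phi> (- x :: real^'n)"
    using fourier_fourier by blast
  (* A third power of the transform avoids the reflection in F\<^sup>-\<^sup>1. *)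
  let ?\<phi> = "\<lambda>x. 1 / c\<^sup>2 * fourier (fourier (fourier \<psi>)) x"
  show ?thesis
  proof
    show "?\<phi> \<in> schwartz"
      by (intro schwartz_cmult schwartz_fourier \<psi>)
    have "fourier ?\<phi> x = \<psi> x" for x
      unfolding fourier_cmult c[OF schwartz_fourier[OF schwartz_fourier[OF \<psi>]]] c[OF \<psi>]
      using \<open>c \<noteq> 0\<close> by (simp add: power2_eq_square)
    then show "fourier ?\<phi> = \<psi>" by blast
  qed
qed

section \<open>Orthonormal rows\<close>

text \<open>
  The adjoint of \<^const>\<open>embed\<close>, for injective \<open>\<iota>\<close>.
\<close>
definition restrict_coordinates :: "('k::finite \<Rightarrow> 'n::finite) \<Rightarrow> real^'n \<Rightarrow> real^'k" where
  "restrict_coordinates \<iota> y = (\<chi> i. y $ \<iota> i)"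

lemma restrict_coordinates_embed: "inj \<iota> \<Longrightarrow> restrict_coordinates \<iota> (embed \<iota> x) = x"
  by (simp add: restrict_coordinates_def embed_nth)

lemma linear_embed: "linear (embed \<iota>)"
  by (auto simp: linear_iff embed_def vec_eq_iff)

lemma inj_embed: "inj \<iota> \<Longrightarrow> inj (embed \<iota>)"
  by (metis injI restrict_coordinates_embed)

lemma inner_embed:
  fixes \<iota> :: "'k::finite \<Rightarrow> 'n::finite"
  assumes "inj \<iota>"
  shows "embed \<iota> x \<bullet> y = x \<bullet> restrict_coordinates \<iota> y"
proof -
  have "embed \<iota> x \<bullet> y = (\<Sum>j\<in>range \<iota>. embed \<iota> x $ j * y $ j)"
    unfolding inner_vec_def
    by (rule sum.mono_neutral_cong_right) (auto simp: embed_nth_outside)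
  also have "\<dots> = (\<Sum>i\<in>UNIV. x $ i * y $ \<iota> i)"
    using assms by (simp add: sum.reindex embed_nth)
  finally show ?thesis
    by (simp add: inner_vec_def restrict_coordinates_def)
qed

lemma orthogonal_matrix_transpose_inverse:
  fixes U :: "real^'n::finite^'n"
  assumes "orthogonal_matrix U"
  shows "U *v (transpose U *v x) = x"
  using assms unfolding orthogonal_matrix_def by (metis matrix_vector_mul_assoc matrix_vector_mul_lid)

text \<open>
  For injective \<open>\<iota>\<close> and orthogonal \<open>U\<close>, the isometric parametrisation of the \<open>k\<close>-dimensional subspace on which the distribution
  \<open>(T\<^sub>f \<otimes> \<delta>)\<^sub>U\<close> is supported.
\<close>
definition subspace_embedding :: "real^'n::finite^'n \<Rightarrow> ('k::finite \<Rightarrow> 'n) \<Rightarrow> real^'k \<Rightarrow> real^'n" where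
  "subspace_embedding U \<iota> x = transpose U *v embed \<iota> x"

text \<open>
  The rows of \<open>U\<close> with indices in the range of \<open>\<iota>\<close>; for injective \<open>\<iota>\<close> this matrix is the
  adjoint of \<open>subspace_embedding U \<iota>\<close>.
\<close>
definition row_block :: "real^'n::finite^'n \<Rightarrow> ('k::finite \<Rightarrow> 'n) \<Rightarrow> real^'n^'k" where
  "row_block U \<iota> = (\<chi> i. U $ \<iota> i)"

lemma row_block_mult: "row_block U \<iota> *v y = restrict_coordinates \<iota> (U *v y)"
  by (simp add: row_block_def restrict_coordinates_def matrix_vector_mult_def vec_eq_iff)

lemma linear_subspace_embedding: "linear (subspace_embedding U \<iota>)"
proof -
  have "linear ((*v) (transpose U) \<circ> embed \<iota>)"
    by (intro linear_compose linear_embed matrix_vector_mul_linear)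
  then show ?thesis
    by (simp add: subspace_embedding_def[abs_def] o_def)
qed

lemma row_block_subspace_embedding:
  assumes "inj \<iota>" "orthogonal_matrix U"
  shows "row_block U \<iota> *v subspace_embedding U \<iota> x = x"
  unfolding row_block_mult subspace_embedding_def
  by (simp only: orthogonal_matrix_transpose_inverse assms restrict_coordinates_embed)

lemma inj_subspace_embedding: "inj \<iota> \<Longrightarrow> orthogonal_matrix U \<Longrightarrow> inj (subspace_embedding U \<iota>)"
  by (metis injI row_block_subspace_embedding)

lemma rank_row_block:
  fixes \<iota> :: "'k::finite \<Rightarrow> 'n::finite"
  assumes "inj \<iota>" "orthogonal_matrix U"
  shows "rank (row_block U \<iota>) = CARD('k)"
  unfolding full_rank_surjective using row_block_subspace_embedding[OF assms] by (metis surjI)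

lemma inner_subspace_embedding:
  assumes "inj \<iota>"
  shows "subspace_embedding U \<iota> x \<bullet> y = x \<bullet> (row_block U \<iota> *v y)"
  unfolding subspace_embedding_def row_block_mult inner_embed[OF assms, symmetric]
  by (simp add: dot_lmul_matrix)

text \<open>
  Choose the rows of \<open>U\<close> with indices in the range of \<open>\<iota>\<close> to be an orthonormal basis of the row space of \<open>B\<close>, and the
  others to be one of its orthogonal complement. As \<open>U\<close> is orthogonal, \<open>B = (B U\<^sup>T) U\<close>, and the columns of \<open>B U\<^sup>T\<close> outside
  the range of \<open>\<iota>\<close> vanish; \<open>C\<close> consists of the remaining columns.
\<close>
lemma full_rank_factorization:
  fixes \<iota> :: "'k::finite \<Rightarrow> 'n::finite" and B :: "real^'n^'k"
  assumes \<iota>: "inj \<iota>" and B: "rank B = CARD('k)"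
  obtains U :: "real^'n^'n" and C :: "real^'k^'k"
  where "orthogonal_matrix U" "inj ((*v) C)" "\<And>x. B *v x = C *v (row_block U \<iota> *v x)"
proof -
  define W where "W = span (rows B)"
  define W' where "W' = {y \<in> (UNIV :: (real^'n) set). \<forall>x\<in>W. orthogonal x y}"
  have W: "subspace W" "dim W = CARD('k)"
    using B by (simp_all add: W_def row_rank_def)
  have W': "subspace W'" "dim W' + CARD('k) = CARD('n)"
    using dim_subspace_orthogonal_to_vectors[OF W(1) subspace_UNIV] W(2)
    by (auto simp: W'_def subspace_def orthogonal_def inner_add_right)
  obtain E where E: "E \<subseteq> W" "pairwise orthogonal E" "\<And>x. x \<in> E \<Longrightarrow> norm x = 1"
    "independent E" "card E = dim W"
    using orthonormal_basis_subspace[OF W(1)] by metis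
  obtain E' where E': "E' \<subseteq> W'" "pairwise orthogonal E'" "\<And>x. x \<in> E' \<Longrightarrow> norm x = 1"
    "independent E'" "card E' = dim W'"
    using orthonormal_basis_subspace[OF W'(1)] by metis
  have "card (range \<iota>) = card E"
    using \<iota> E(5) W(2) by (simp add: card_image)
  then obtain g where g: "bij_betw g (range \<iota>) E"
    using finite_same_card_bij[OF finite independent_imp_finite[OF E(4)]] by blast
  have "card (- range \<iota>) = card E'"
    using \<iota> E'(5) W'(2) by (simp add: Compl_eq_Diff_UNIV card_Diff_subset card_image)
  then obtain h where h: "bij_betw h (- range \<iota>) E'"
    using finite_same_card_bij[OF finite independent_imp_finite[OF E'(4)]] by blast
  define u where "u j = (if j \<in> range \<iota> then g j else h j)" for j
  have u_in: "u j \<in> E" if "j \<in> range \<iota>" for j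
    using that bij_betwE[OF g] by (auto simp: u_def)
  have u_out: "u j \<in> E'" if "j \<notin> range \<iota>" for j
    using that bij_betwE[OF h] by (simp add: u_def)
  have u_inj: "u i \<noteq> u j" if "i \<noteq> j" "i \<in> range \<iota> \<longleftrightarrow> j \<in> range \<iota>" for i j
  proof (cases "i \<in> range \<iota>")
    case True
    then have "i \<in> range \<iota>" "j \<in> range \<iota>" "g i \<noteq> g j"
      using that inj_onD[OF bij_betw_imp_inj_on[OF g], of i j] by blast+
    then show ?thesis by (simp only: u_def if_True not_False_eq_True)
  next
    case False
    then have "i \<notin> range \<iota>" "j \<notin> range \<iota>" "h i \<noteq> h j"
      using that inj_onD[OF bij_betw_imp_inj_on[OF h], of i j] by blast+
    then show ?thesis by (simp only: u_def if_False not_False_eq_True)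
  qed
  have cross: "orthogonal x y" if "x \<in> E" "y \<in> E'" for x y
    using that E(1) E'(1) by (auto simp: W'_def)
  define U :: "real^'n^'n" where "U = (\<chi> j. u j)"
  have row_U: "row j U = u j" for j
    by (simp add: U_def row_def vec_eq_iff)
  have U: "orthogonal_matrix U"
    unfolding orthogonal_matrix_orthonormal_rows row_U
  proof (intro conjI allI impI)
    show "norm (u j) = 1" for j
      using u_in u_out E(3) E'(3) by blast
    show "orthogonal (u i) (u j)" if "i \<noteq> j" for i j
    proof (cases "i \<in> range \<iota>"; cases "j \<in> range \<iota>")
      assume "i \<in> range \<iota>" "j \<in> range \<iota>"
      then show ?thesis
        using u_inj[OF that] u_in E(2) by (auto simp: pairwise_def)
    next
      assume "i \<in> range \<iota>" "j \<notin> range \<iota>"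
      then show ?thesis
        by (intro cross u_in u_out)
    next
      assume "i \<notin> range \<iota>" "j \<in> range \<iota>"
      then have "orthogonal (u j) (u i)"
        by (intro cross u_in u_out)
      then show ?thesis by (simp add: orthogonal_commute)
    next
      assume "i \<notin> range \<iota>" "j \<notin> range \<iota>"
      then show ?thesis
        using u_inj[OF that] u_out E'(2) by (auto simp: pairwise_def)
    qed
  qed
  define C :: "real^'k^'k" where "C = (\<chi> i l. row i B \<bullet> u (\<iota> l))"
  have fact: "B *v x = C *v (row_block U \<iota> *v x)" for x
  proof -
    have "(B *v x) $ i = (C *v (row_block U \<iota> *v x)) $ i" for i
    proof -
      have zero: "row i B \<bullet> u j = 0" if "j \<notin> range \<iota>" for j
      proof -
        have "row i B \<in> W"
          by (auto simp: W_def rows_def intro: span_base)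
        then show ?thesis
          using u_out[OF that] E'(1) by (auto simp: W'_def orthogonal_def)
      qed
      have "(B *v x) $ i = row i B \<bullet> x"
        by (simp add: matrix_vector_mult_def inner_vec_def row_def)
      also have "\<dots> = row i B \<bullet> (transpose U *v (U *v x))"
        using U unfolding orthogonal_matrix_def by (metis matrix_vector_mul_assoc matrix_vector_mul_lid)
      also have "\<dots> = (U *v row i B) \<bullet> (U *v x)"
        using dot_lmul_matrix[of "U *v x" U "row i B"] by (simp add: inner_commute)
      also have "\<dots> = (\<Sum>j\<in>UNIV. (row i B \<bullet> u j) * (U *v x) $ j)"
        by (simp add: inner_vec_def matrix_vector_mult_def U_def mult.commute)
      also have "\<dots> = (\<Sum>j\<in>range \<iota>. (row i B \<bullet> u j) * (U *v x) $ j)"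
        by (rule sum.mono_neutral_right) (auto simp: zero)
      also have "\<dots> = (\<Sum>l\<in>UNIV. (row i B \<bullet> u (\<iota> l)) * (U *v x) $ \<iota> l)"
        using \<iota> by (simp add: sum.reindex)
      also have "\<dots> = (C *v restrict_coordinates \<iota> (U *v x)) $ i"
        by (simp add: C_def restrict_coordinates_def matrix_vector_mult_def[of "\<chi> i l. row i B \<bullet> u (\<iota> l)"])
      finally show ?thesis
        by (simp add: row_block_mult)
    qed
    then show ?thesis by (simp add: vec_eq_iff)
  qed
  have "surj ((*v) B)"
    using B by (simp add: full_rank_surjective)
  then have "surj ((*v) C)"
    unfolding surj_def fact by blast
  then have "inj ((*v) C)"
    by (intro linear_surjective_imp_injective matrix_vector_mul_linear) auto
  with U fact show ?thesis
    by (intro that) auto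
qed

section \<open>The two families of distributions\<close>

lemma rotate_tensor_delta_apply:
  fixes \<iota> :: "'k::finite \<Rightarrow> 'n::finite"
  assumes "inj \<iota>" "orthogonal_matrix U" and \<phi>: "\<phi> \<in> schwartz"
  shows "rotate_dist U (tensor_delta \<iota> (regular_dist f)) \<phi> = (\<integral>x. f x * \<phi> (subspace_embedding U \<iota> x) \<partial>lborel)"
proof -
  have U': "orthogonal_matrix (transpose U)"
    using assms(2) by simp
  have "inj ((*v) (transpose U))"
    using orthogonal_matrix_transpose_inverse[OF assms(2)] by (metis injI)
  then have 1: "(\<lambda>x. \<phi> (transpose U *v x)) \<in> schwartz"
    by (intro schwartz_linear[OF \<phi>] matrix_vector_mul_linear)
  have 2: "(\<lambda>x. \<phi> (transpose U *v embed \<iota> x)) \<in> schwartz"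
    by (rule schwartz_linear[OF 1 linear_embed inj_embed[OF assms(1)]])
  show ?thesis
    using \<phi> 1 2 by (simp add: rotate_dist_def tensor_delta_def regular_dist_def subspace_embedding_def del: transpose_matrix_vector)
qed

lemma schwartz_seminorm_zero: "schwartz_seminorm \<alpha> \<beta> (\<lambda>x. 0) = 0"
proof -
  have "partial_derivs \<beta> (\<lambda>x. 0) = (\<lambda>x. 0)"
    by (induction \<beta>) (auto simp: partial_derivs_def partial_deriv_eq[OF has_derivative_const])
  then show ?thesis by (simp add: schwartz_seminorm_def)
qed

lemma topspace_schwartz_topology:
  "topspace schwartz_topology = (schwartz :: (real^'n::finite \<Rightarrow> complex) set)"
proof -
  let ?N = "\<lambda>\<alpha> \<beta> (\<phi> :: real^'n \<Rightarrow> complex) \<epsilon>. {\<psi> \<in> schwartz. schwartz_seminorm \<alpha> \<beta> (\<lambda>x. \<psi> x - \<phi> x) < (\<epsilon>::real)}"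
  let ?B = "{?N \<alpha> \<beta> \<phi> \<epsilon> | \<alpha> \<beta> \<phi> \<epsilon>. \<phi> \<in> schwartz \<and> \<epsilon> > 0}"
  have covered: "\<phi> \<in> \<Union>?B" if \<phi>: "\<phi> \<in> schwartz" for \<phi>
  proof (rule UnionI)
    show "?N (\<lambda>_. 0) [] \<phi> 1 \<in> ?B"
      using \<phi> zero_less_one by blast
    show "\<phi> \<in> ?N (\<lambda>_. 0) [] \<phi> 1"
      using \<phi> by (simp add: schwartz_seminorm_zero)
  qed
  have "\<Union>?B = schwartz"
  proof (rule equalityI)
    show "\<Union>?B \<subseteq> schwartz" by blast
    show "schwartz \<subseteq> \<Union>?B" by (rule subsetI) (rule covered)
  qed
  then show ?thesis
    unfolding schwartz_topology_def topology_generated_by_topspace .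
qed

lemma norm_le_schwartz_seminorm:
  assumes "\<phi> \<in> schwartz"
  shows "norm (\<phi> x) \<le> schwartz_seminorm (\<lambda>_. 0) [] \<phi>"
proof -
  obtain C where "\<And>x. norm (\<phi> x) \<le> C"
    using schwartz_bounded[OF assms] by blast
  then have "bdd_above (range (\<lambda>x. norm (\<phi> x)))" by (auto simp: bdd_above_def)
  then show ?thesis
    by (auto simp: schwartz_seminorm_def partial_derivs_def monomial_def intro: cSUP_upper)
qed

text \<open>
  A bound by a single seminorm suffices for continuity: sets of the form
  \<open>{\<psi>. \<parallel>\<psi> - \<phi>\<parallel> < \<epsilon>}\<close> for that seminorm are among the generators of the topology.
\<close>
lemma temperedI:
  fixes T :: "'n::finite distribution"
  assumes ext: "T \<in> extensional schwartz"
    and add: "\<And>\<phi> \<psi>. \<phi> \<in> schwartz \<Longrightarrow> \<psi> \<in> schwartz \<Longrightarrow> T (\<lambda>x. \<phi> x + \<psi> x) = T \<phi> + T \<psi>"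
    and scale: "\<And>c \<phi>. \<phi> \<in> schwartz \<Longrightarrow> T (\<lambda>x. c * \<phi> x) = c * T \<phi>"
    and bound: "\<And>\<phi>. \<phi> \<in> schwartz \<Longrightarrow> norm (T \<phi>) \<le> M * schwartz_seminorm \<alpha> \<beta> \<phi>"
    and M: "M \<ge> 0"
  shows "T \<in> tempered"
proof -
  have "openin schwartz_topology {\<phi> \<in> schwartz. T \<phi> \<in> V}" if "open V" for V
  proof (subst openin_subopen, intro ballI)
    fix \<phi>
    assume "\<phi> \<in> {\<phi> \<in> schwartz. T \<phi> \<in> V}"
    then have \<phi>: "\<phi> \<in> schwartz" "T \<phi> \<in> V" by auto
    obtain e where e: "e > 0" "ball (T \<phi>) e \<subseteq> V"
      using \<open>open V\<close> \<phi>(2) openE by blast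
    let ?N = "\<lambda>d. {\<psi> \<in> schwartz. schwartz_seminorm \<alpha> \<beta> (\<lambda>x. \<psi> x - \<phi> x) < d}"
    (* The denominator is M + 1 because M may be 0. *)
    have d: "e / (M + 1) > 0"
      using e(1) M by simp
    have "openin schwartz_topology (?N (e / (M + 1)))"
      unfolding schwartz_topology_def using \<phi>(1) d by (intro topology_generated_by_Basis) blast
    moreover have "\<phi> \<in> ?N (e / (M + 1))"
      using \<phi>(1) d by (simp add: schwartz_seminorm_zero)
    moreover have "?N (e / (M + 1)) \<subseteq> {\<phi> \<in> schwartz. T \<phi> \<in> V}"
    proof
      fix \<psi> assume "\<psi> \<in> ?N (e / (M + 1))"
      then have \<psi>: "\<psi> \<in> schwartz" "schwartz_seminorm \<alpha> \<beta> (\<lambda>x. \<psi> x - \<phi> x) < e / (M + 1)" by auto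
      have "T (\<lambda>x. \<psi> x + (-1) * \<phi> x) = T \<psi> + (-1) * T \<phi>"
        using \<psi>(1) \<phi>(1) by (simp only: add scale schwartz_cmult)
      then have diff: "T (\<lambda>x. \<psi> x - \<phi> x) = T \<psi> - T \<phi>" by simp
      have "(\<lambda>x. \<psi> x - \<phi> x) \<in> schwartz"
        using schwartz_add[OF \<psi>(1) schwartz_cmult[OF \<phi>(1), of "-1"]] by simp
      then have "norm (T \<psi> - T \<phi>) \<le> M * schwartz_seminorm \<alpha> \<beta> (\<lambda>x. \<psi> x - \<phi> x)"
        using bound diff by metis
      also have "\<dots> \<le> M * (e / (M + 1))"
        using \<psi>(2) M by (intro mult_left_mono) auto
      also have "\<dots> < e"
        using M e(1) by (simp add: field_simps)
      finally have "T \<psi> \<in> ball (T \<phi>) e"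
        by (simp add: dist_norm norm_minus_commute)
      then show "\<psi> \<in> {\<phi> \<in> schwartz. T \<phi> \<in> V}"
        using e(2) \<psi>(1) by auto
    qed
    ultimately show "\<exists>N. openin schwartz_topology N \<and> \<phi> \<in> N \<and> N \<subseteq> {\<phi> \<in> schwartz. T \<phi> \<in> V}"
      by blast
  qed
  then have "continuous_map schwartz_topology euclidean T"
    by (auto simp: continuous_map topspace_schwartz_topology)
  then show ?thesis
    using ext add scale by (simp add: tempered_def)
qed

text \<open>
  The pairing with \<open>\<phi>\<close> is at most \<open>\<integral> \<bar>f\<bar>\<close> times the supremum of \<open>\<bar>\<phi>\<bar>\<close>.
\<close>
lemma G_family_subset_tempered:
  fixes \<iota> :: "'k::finite \<Rightarrow> 'n::finite"
  assumes \<iota>: "inj \<iota>"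
  shows "G_family \<iota> \<subseteq> tempered"
proof
  fix T assume "T \<in> G_family \<iota>"
  then obtain f U where f: "f \<in> schwartz" and U: "orthogonal_matrix U"
    and T: "T = rotate_dist U (tensor_delta \<iota> (regular_dist f))"
    by (auto simp: G_family_def)
  have T_apply: "T \<phi> = (\<integral>x. f x * \<phi> (subspace_embedding U \<iota> x) \<partial>lborel)" if "\<phi> \<in> schwartz" for \<phi>
    unfolding T by (rule rotate_tensor_delta_apply[OF \<iota> U that])
  have int_bound: "integrable lborel (\<lambda>x. norm (f x) * C)" for C
    by (intro integrable_mult_left integrable_norm schwartz_integrable f)
  have int: "integrable lborel (\<lambda>x. f x * \<phi> (subspace_embedding U \<iota> x))" if \<phi>: "\<phi> \<in> schwartz" for \<phi>
  proof (rule Bochner_Integration.integrable_bound[OF int_bound])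
    have "(\<lambda>x. \<phi> (subspace_embedding U \<iota> x)) \<in> schwartz"
      by (rule schwartz_linear[OF \<phi> linear_subspace_embedding inj_subspace_embedding[OF \<iota> U]])
    then show "(\<lambda>x. f x * \<phi> (subspace_embedding U \<iota> x)) \<in> borel_measurable lborel"
      using f by (auto dest!: schwartz_measurable)
    show "AE x in lborel. norm (f x * \<phi> (subspace_embedding U \<iota> x)) \<le> norm (norm (f x) * schwartz_seminorm (\<lambda>_. 0) [] \<phi>)"
      using norm_le_schwartz_seminorm[OF \<phi>] by (auto simp: norm_mult abs_mult intro!: mult_left_mono order_trans[OF _ abs_ge_self])
  qed
  show "T \<in> tempered"
  proof (rule temperedI)
    show "T \<in> extensional schwartz"
      by (simp add: T rotate_dist_def)
    show "T (\<lambda>x. \<phi> x + \<psi> x) = T \<phi> + T \<psi>" if "\<phi> \<in> schwartz" "\<psi> \<in> schwartz" for \<phi> \<psi>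
      using that by (simp add: T_apply schwartz_add distrib_left int)
    show "T (\<lambda>x. c * \<phi> x) = c * T \<phi>" if "\<phi> \<in> schwartz" for c \<phi>
      using that by (simp add: T_apply schwartz_cmult mult.left_commute[of _ c])
    show "norm (T \<phi>) \<le> (\<integral>x. norm (f x) \<partial>lborel) * schwartz_seminorm (\<lambda>_. 0) [] \<phi>" if \<phi>: "\<phi> \<in> schwartz" for \<phi>
    proof -
      have "norm (T \<phi>) \<le> (\<integral>x. norm (f x * \<phi> (subspace_embedding U \<iota> x)) \<partial>lborel)"
        unfolding T_apply[OF \<phi>] by (rule integral_norm_bound)
      also have "\<dots> \<le> (\<integral>x. norm (f x) * schwartz_seminorm (\<lambda>_. 0) [] \<phi> \<partial>lborel)"
        by (intro integral_mono integrable_norm int \<phi> int_bound)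
           (simp add: norm_mult mult_left_mono norm_le_schwartz_seminorm \<phi>)
      finally show ?thesis by simp
    qed
    show "(\<integral>x. norm (f x) \<partial>lborel) \<ge> 0" by simp
  qed
qed

text \<open>
  A distribution is determined by its values on the functions \<open>F\<phi>\<close>, because these are all the Schwartz functions.
\<close>
lemma inj_on_fourier_dist_tempered: "inj_on fourier_dist (tempered :: 'n::finite distribution set)"
proof (rule inj_onI)
  fix S T :: "'n distribution"
  assume "S \<in> tempered" "T \<in> tempered" and eq: "fourier_dist S = fourier_dist T"
  then have ext: "S \<in> extensional schwartz" "T \<in> extensional schwartz"
    by (auto simp: tempered_def)
  from ext show "S = T"
  proof (rule extensionalityI)
    fix \<psi> :: "real^'n \<Rightarrow> complex"
    assume "\<psi> \<in> schwartz"
    then obtain \<phi> where "\<phi> \<in> schwartz" "fourier \<phi> = \<psi>"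
      by (rule fourier_surj_schwartz)
    then show "S \<psi> = T \<psi>"
      using fun_cong[OF eq, of \<phi>] by (auto simp: fourier_dist_def)
  qed
qed

lemma fourier_dist_rotate_tensor_delta:
  fixes \<iota> :: "'k::finite \<Rightarrow> 'n::finite"
  assumes \<iota>: "inj \<iota>" and U: "orthogonal_matrix U" and f: "f \<in> schwartz"
  shows "fourier_dist (rotate_dist U (tensor_delta \<iota> (regular_dist f)))
    = regular_dist (\<lambda>x. fourier f (row_block U \<iota> *v x))"
proof (rule extensionalityI[of _ schwartz])
  fix \<phi> :: "real^'n \<Rightarrow> complex"
  assume \<phi>: "\<phi> \<in> schwartz"
  have "fourier_dist (rotate_dist U (tensor_delta \<iota> (regular_dist f))) \<phi>
      = (\<integral>x. f x * fourier \<phi> (subspace_embedding U \<iota> x) \<partial>lborel)"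
    using \<phi> by (simp add: fourier_dist_def rotate_tensor_delta_apply[OF \<iota> U schwartz_fourier])
  also have "\<dots> = (\<integral>y. fourier f (row_block U \<iota> *v y) * \<phi> y \<partial>lborel)"
    by (intro integral_mult_fourier schwartz_integrable f \<phi> linear_subspace_embedding inner_subspace_embedding \<iota>)
  finally show "fourier_dist (rotate_dist U (tensor_delta \<iota> (regular_dist f))) \<phi>
      = regular_dist (\<lambda>x. fourier f (row_block U \<iota> *v x)) \<phi>"
    using \<phi> by (simp add: regular_dist_def)
qed (simp_all add: fourier_dist_def regular_dist_def)

theorem theorem2:
  fixes \<iota> :: "'k::finite \<Rightarrow> 'n::finite"
  assumes "inj \<iota>"
  shows "fourier_dist ` G_family \<iota> = F_family TYPE('k)
       \<and> inv_fourier_dist ` F_family TYPE('k) = G_family \<iota>"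
proof -
  have image: "fourier_dist ` G_family \<iota> = F_family TYPE('k)"
  proof (intro equalityI subsetI)
    fix S assume "S \<in> fourier_dist ` G_family \<iota>"
    then obtain f U where f: "f \<in> schwartz" and U: "orthogonal_matrix U"
      and S: "S = regular_dist (\<lambda>x. fourier f (row_block U \<iota> *v x))"
      by (auto simp: G_family_def fourier_dist_rotate_tensor_delta[OF assms])
    then show "S \<in> F_family TYPE('k)"
      using schwartz_fourier[OF f] rank_row_block[OF assms U] by (auto simp: F_family_def)
  next
    fix S assume "S \<in> (F_family TYPE('k) :: 'n distribution set)"
    then obtain f :: "real^'k \<Rightarrow> complex" and B :: "real^'n^'k" where f: "f \<in> schwartz"
      and B: "rank B = CARD('k)" and S: "S = regular_dist (\<lambda>x. f (B *v x))"
      by (auto simp: F_family_def)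
    obtain U C where U: "orthogonal_matrix U" and C: "inj ((*v) C)"
      and fact: "\<And>x. B *v x = C *v (row_block U \<iota> *v x)"
      using full_rank_factorization[OF assms B] by blast
    have "(\<lambda>x. f (C *v x)) \<in> schwartz"
      by (rule schwartz_linear[OF f matrix_vector_mul_linear C])
    then obtain g where g: "g \<in> schwartz" "fourier g = (\<lambda>x. f (C *v x))"
      by (rule fourier_surj_schwartz)
    have "S = fourier_dist (rotate_dist U (tensor_delta \<iota> (regular_dist g)))"
      unfolding fourier_dist_rotate_tensor_delta[OF assms U g(1)] S by (simp add: g(2) fact)
    then show "S \<in> fourier_dist ` G_family \<iota>"
      using U g(1) by (auto simp: G_family_def)
  qed
  have "inv_fourier_dist (fourier_dist T) = T" if "T \<in> G_family \<iota>" for T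
    unfolding inv_fourier_dist_def
    using that G_family_subset_tempered[OF assms] by (intro the_inv_into_f_f inj_on_fourier_dist_tempered) auto
  then have "inv_fourier_dist ` F_family TYPE('k) = G_family \<iota>"
    unfolding image[symmetric] image_image by simp
  with image show ?thesis by blast
qed

end
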